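(* There exists an absolute constant $C>0$ such that for every integer $n \ge 4$, \[ \overline{\operatorname{cr}}(K_n) \le \frac{9363184}{24609375}\binom{n}{4} + C n^3 . \] In particular $\overline{\operatorname{cr}}(K_n) \le 0.380473\binom{n}{4} + O(n^3)$.
   Context: A set of points in the plane is in general position if no three of its points are collinear. For a finite set $S$ of points in general position in the plane, $\overline{\operatorname{cr}}(S)$ denotes the number of pairs of edges that cross (at a point interior to both segments) in the rectilinear drawing of the complete graph on vertex set $S$, i.e. the drawing in which every pair of points of $S$ is joined by the straight line segment between them. The rectilinear crossing number $\overline{\operatorname{cr}}(K_n)$ is the minimum of $\overline{\operatorname{cr}}(S)$ over all sets $S$ of $n$ points in general position in the plane. *)

theory Defs
  imports "HOL-Analysis.Analysis"
begin

type_synonym point = "real \<times> real"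

definition general_position :: "point set \<Rightarrow> bool" where
  "general_position S \<longleftrightarrow>
     (\<forall>a\<in>S. \<forall>b\<in>S. \<forall>c\<in>S. a \<noteq> b \<and> a \<noteq> c \<and> b \<noteq> c \<longrightarrow> \<not> collinear {a, b, c})"

definition edges :: "point set \<Rightarrow> point set set" where
  "edges S = {e. e \<subseteq> S \<and> card e = 2}"

definition edges_cross :: "point set \<Rightarrow> point set \<Rightarrow> bool" where
  "edges_cross e f \<longleftrightarrow>
     (\<exists>a b c d. e = {a, b} \<and> f = {c, d} \<and> open_segment a b \<inter> open_segment c d \<noteq> {})"

definition cr_set :: "point set \<Rightarrow> nat" where
  "cr_set S = card {{e, f} | e f. e \<in> edges S \<and> f \<in> edges S \<and> e \<noteq> f \<and> edges_cross e f}"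

definition rect_cr :: "nat \<Rightarrow> nat" where
  "rect_cr n = Inf {cr_set S | S. finite S \<and> card S = n \<and> general_position S}"

end

theory Submission
  imports Defs
begin

text \<open>
  Let \<open>y n\<close> be the least number of ordered crossings (eight times the crossings) of \<open>n\<close> points. Averaging over
  subsets shows that \<open>y n / n ^ 4\<close> is nondecreasing for \<open>n \<ge> 4\<close>. Take a fixed point set with positive integer
  weights \<open>w p\<close> of sum \<open>W\<close>, and a line through each of its points. Replace each point \<open>p\<close> by a tiny copy of an
  optimal set of \<open>w p * n\<close> points, flattened along the line of \<open>p\<close>. The crossings of the resulting \<open>W * n\<close> points
  are classified by which of the four end points share a cluster: up to a summand \<open>G * n ^ 4\<close> that depends only on the
  weighted set they lie inside the clusters, whence \<open>y (W n) \<le> G n ^ 4 + (\<Sum>p. y (w p n))\<close>. Monotonicity of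
  \<open>y n / n ^ 4\<close> turns this recursion into \<open>y n \<le> G n ^ 4 / (W ^ 4 - (\<Sum>p. w p ^ 4))\<close>. A weighted set of 57 points with
  threefold affine symmetry makes the quotient small enough.
\<close>

section \<open>Orientations and crossings\<close>

text \<open>Flattening makes the line chosen at \<open>p\<close> decide most crossings near
  \<open>p\<close>: edges leaving its cluster for two other clusters can cross only if both of these
  lie on the same side of the line. The cost \<open>left_sum ^ 2 + right_sum ^ 2\<close> of a line
  is least when it halves the remaining weight, and the chosen directions nearly do this. The
  comparisons of \<open>y\<close> at \<open>n\<close>, \<open>w p * n\<close> and
  \<open>W * n\<close> are exact, so no error term accumulates; the cubic term of the theorem only
  pays for replacing \<open>n ^ 4 / 24\<close> by \<open>n choose 4\<close>. The numerical check has
  to avoid a sum over \<open>57 ^ 4\<close> quadruples. An identity expresses the crossings by the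
  imbalances of the lines through two points, and one sorted sweep around each point yields all
  imbalances of lines through it. The symmetry of the 57 points is the linear map
  \<open>(x, y) |-> (- y, x - y)\<close> of order three, with 19 orbits of constant weight.\<close>

definition orient :: "point \<Rightarrow> point \<Rightarrow> point \<Rightarrow> real" where
  "orient a b c = (fst b - fst a) * (snd c - snd a) - (snd b - snd a) * (fst c - fst a)"

lemma orient_swap: "orient b a c = - orient a b c"
  and orient_rotate: "orient a b c = orient b c a"
  by (simp_all add: orient_def algebra_simps)

lemma orient_same [simp]: "orient a a c = 0" "orient a b a = 0" "orient a b b = 0"
  by (simp_all add: orient_def algebra_simps)

lemma orient_eq_0_if_collinear:
  assumes "collinear {a, b, c}" shows "orient a b c = 0"
proof -
  obtain u where u: "\<And>x y. x \<in> {a, b, c} \<Longrightarrow> y \<in> {a, b, c} \<Longrightarrow> \<exists>t. x - y = t *\<^sub>R u"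
    using assms unfolding collinear_def by blast
  obtain s t where st: "b - a = s *\<^sub>R u" "c - a = t *\<^sub>R u"
    using u[of b a] u[of c a] by auto
  have "fst b - fst a = s * fst u" "snd b - snd a = s * snd u"
    "fst c - fst a = t * fst u" "snd c - snd a = t * snd u"
    using arg_cong[OF st(1), of fst] arg_cong[OF st(1), of snd]
      arg_cong[OF st(2), of fst] arg_cong[OF st(2), of snd] by simp_all
  then show ?thesis by (simp add: orient_def)
qed

text \<open>The strict inequalities fail as soon as two of the points coincide, so ordered
  quadruples can be counted without distinctness conditions.\<close>

definition crossing :: "point \<Rightarrow> point \<Rightarrow> point \<Rightarrow> point \<Rightarrow> bool" where
  "crossing a b c d \<longleftrightarrow> orient a b c * orient a b d < 0 \<and> orient c d a * orient c d b < 0"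

definition crossings :: "point set \<Rightarrow> (point \<times> point \<times> point \<times> point) set" where
  "crossings S = {(a, b, c, d). a \<in> S \<and> b \<in> S \<and> c \<in> S \<and> d \<in> S \<and> crossing a b c d}"

text \<open>Distinct abscissae are demanded because the substitution below flattens configurations vertically.\<close>

definition generic :: "point set \<Rightarrow> bool" where
  "generic S \<longleftrightarrow> finite S \<and> inj_on fst S \<and>
     (\<forall>a\<in>S. \<forall>b\<in>S. \<forall>c\<in>S. a \<noteq> b \<and> a \<noteq> c \<and> b \<noteq> c \<longrightarrow> orient a b c \<noteq> 0)"

lemma generic_imp_general_position: "generic S \<Longrightarrow> general_position S"
  unfolding generic_def general_position_def using orient_eq_0_if_collinear by blast

lemma crossing_sym:
  "crossing b a c d \<longleftrightarrow> crossing a b c d"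
  "crossing a b d c \<longleftrightarrow> crossing a b c d"
  "crossing c d a b \<longleftrightarrow> crossing a b c d"
  unfolding crossing_def using orient_swap[of b a] orient_swap[of d c]
  by (auto simp: mult.commute)

lemma crossing_distinct:
  "crossing a b c d \<Longrightarrow> a \<noteq> b \<and> a \<noteq> c \<and> a \<noteq> d \<and> b \<noteq> c \<and> b \<noteq> d \<and> c \<noteq> d"
  by (auto simp: crossing_def)

lemma finite_crossings: "finite S \<Longrightarrow> finite (crossings S)"
  by (rule finite_subset[of _ "S \<times> S \<times> S \<times> S"]) (auto simp: crossings_def)

lemma orient_affine:
  "orient a b ((1 - t) *\<^sub>R c + t *\<^sub>R d) = (1 - t) * orient a b c + t * orient a b d"
  by (simp add: orient_def algebra_simps)

text \<open>\<open>orient a b\<close> is affine along the segment from \<open>c\<close> to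
  \<open>d\<close> and vanishes at the inner point \<open>x\<close>, so its values at the ends are
  opposite or both zero. Both being zero would put \<open>c\<close> and \<open>d\<close> on the line
  through \<open>a\<close> and \<open>b\<close>, which genericity permits only if the two edges
  coincide.\<close>

lemma orient_mult_neg_if_meet:
  assumes "x \<in> open_segment a b" "x \<in> open_segment c d" "generic S"
    "a \<in> S" "b \<in> S" "c \<in> S" "d \<in> S" "{a, b} \<noteq> {c, d}"
  shows "orient a b c * orient a b d < 0"
proof -
  obtain s where s: "0 < s" "s < 1" "x = (1 - s) *\<^sub>R a + s *\<^sub>R b" and ab: "a \<noteq> b"
    using assms(1) by (auto simp: in_segment)
  obtain t where t: "0 < t" "t < 1" "x = (1 - t) *\<^sub>R c + t *\<^sub>R d" and cd: "c \<noteq> d"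
    using assms(2) by (auto simp: in_segment)
  have "orient a b x = 0" using s(3) orient_affine[of a b s a b] by simp
  then have eq: "(1 - t) * orient a b c + t * orient a b d = 0" using t(3) by (simp add: orient_affine)
  have "orient a b c \<noteq> 0"
  proof
    assume 0: "orient a b c = 0"
    with eq t have "orient a b d = 0" by simp
    with 0 ab assms(3-7) have "c = a \<or> c = b" "d = a \<or> d = b" unfolding generic_def by metis+
    with cd ab assms(8) show False by auto
  qed
  moreover have "orient a b d = - ((1 - t) / t) * orient a b c"
    using eq t by (simp add: field_simps)
  ultimately have "orient a b c * orient a b d = - ((1 - t) / t * (orient a b c)\<^sup>2)"
    and "(1 - t) / t * (orient a b c)\<^sup>2 > 0"
    using t by (simp add: power2_eq_square, intro mult_pos_pos) simp_all
  then show ?thesis by linarith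
qed

lemma crossing_if_edges_cross:
  assumes "generic S" "{a, b} \<in> edges S" "{c, d} \<in> edges S" "{a, b} \<noteq> {c, d}"
    "edges_cross {a, b} {c, d}"
  shows "crossing a b c d"
proof -
  have S: "a \<in> S" "b \<in> S" "c \<in> S" "d \<in> S" using assms by (auto simp: edges_def)
  obtain a' b' c' d' where e: "{a, b} = {a', b'}" "{c, d} = {c', d'}"
    and x: "open_segment a' b' \<inter> open_segment c' d' \<noteq> {}"
    using assms(5) unfolding edges_cross_def by blast
  have "open_segment a' b' = open_segment a b" "open_segment c' d' = open_segment c d"
    using e by (metis doubleton_eq_iff open_segment_commute)+
  with x obtain x where "x \<in> open_segment a b" "x \<in> open_segment c d" by auto
  then show ?thesis
    using orient_mult_neg_if_meet[of x a b c d S] orient_mult_neg_if_meet[of x c d a b S] assms(1,4) S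
    unfolding crossing_def by simp
qed

text \<open>An unordered crossing has eight ordered versions: the ends of either edge may be
  exchanged, and so may the two edges. Versions of different crossings are distinct because
  \<open>g\<close> recovers the crossing.\<close>

lemma eight_cr_set_le:
  assumes "generic S"
  shows "8 * cr_set S \<le> card (crossings S)"
proof -
  define Z where "Z = {{e, f} | e f. e \<in> edges S \<and> f \<in> edges S \<and> e \<noteq> f \<and> edges_cross e f}"
  define g where "g = (\<lambda>(a, b, c, d). {{a, b}, {c, d}} :: point set set)"
  have fin: "finite S" using assms by (simp add: generic_def)
  have finX: "finite (crossings S)" using fin by (rule finite_crossings)
  have finZ: "finite Z"
    by (rule finite_subset[of _ "Pow (Pow S)"]) (auto simp: Z_def edges_def fin)
  have fibre: "8 \<le> card {x \<in> crossings S. g x = z}" if z: "z \<in> Z" for z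
  proof -
    obtain e f where ef: "z = {e, f}" "e \<in> edges S" "f \<in> edges S" "e \<noteq> f" "edges_cross e f"
      using z unfolding Z_def by blast
    have "card e = 2" "card f = 2" using ef(2,3) by (simp_all add: edges_def)
    then obtain a b c d where abcd: "e = {a, b}" "f = {c, d}" by (metis card_2_iff)
    have cr: "crossing a b c d"
      using crossing_if_edges_cross[OF assms, of a b c d] ef(2-5) unfolding abcd by simp
    have S: "a \<in> S" "b \<in> S" "c \<in> S" "d \<in> S"
      using ef(2,3) unfolding abcd by (simp_all add: edges_def)
    let ?F = "{(a,b,c,d),(b,a,c,d),(a,b,d,c),(b,a,d,c),(c,d,a,b),(d,c,a,b),(c,d,b,a),(d,c,b,a)}"
    have "?F \<subseteq> {x \<in> crossings S. g x = z}"
      using S cr by (simp add: crossings_def g_def ef(1) abcd crossing_sym insert_commute)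
    then have "card ?F \<le> card {x \<in> crossings S. g x = z}"
      using finX by (intro card_mono) simp_all
    moreover have "card ?F = 8"
      using crossing_distinct[OF cr] by simp
    ultimately show ?thesis by simp
  qed
  have "8 * card Z = (\<Sum>z\<in>Z. 8)" by simp
  also have "\<dots> \<le> (\<Sum>z\<in>Z. card {x \<in> crossings S. g x = z})" by (rule sum_mono) (rule fibre)
  also have "\<dots> = card (\<Union>z\<in>Z. {x \<in> crossings S. g x = z})"
    using finX finZ by (subst card_UN_disjoint) auto
  also have "\<dots> \<le> card (crossings S)" using finX by (intro card_mono) auto
  finally show ?thesis by (simp add: cr_set_def Z_def)
qed

lemma rect_cr_le:
  assumes "generic S" shows "8 * rect_cr (card S) \<le> card (crossings S)"
proof -
  have "rect_cr (card S) \<le> cr_set S"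
    unfolding rect_cr_def using assms generic_imp_general_position[OF assms]
    by (intro cInf_lower) (auto simp: generic_def)
  with eight_cr_set_le[OF assms] show ?thesis by simp
qed

section \<open>Averaging over subsets\<close>

lemma generic_subset: "generic T \<Longrightarrow> U \<subseteq> T \<Longrightarrow> generic U"
  unfolding generic_def by (meson finite_subset inj_on_subset subset_iff)

text \<open>On the parabola the orientation is a Vandermonde determinant. Generic sets of every size
  are needed for \<open>min_crossings\<close> to be attained.\<close>

lemma generic_parabola: "generic ((\<lambda>i. (real i, (real i)\<^sup>2)) ` {..<n})"
proof -
  have "orient (x, x\<^sup>2) (y, y\<^sup>2) (z, z\<^sup>2) = (y - x) * (z - x) * (z - y)" for x y z
    by (simp add: orient_def algebra_simps power2_eq_square)
  then show ?thesis by (auto simp: generic_def inj_on_def)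
qed

lemma exists_generic: "\<exists>S. generic S \<and> card S = n"
  by (rule exI[of _ "(\<lambda>i. (real i, (real i)\<^sup>2)) ` {..<n}"])
    (auto simp: generic_parabola card_image inj_on_def)

lemma card_supersets:
  assumes "finite T" "D \<subseteq> T" "card D = d" "d \<le> n"
  shows "card {U. D \<subseteq> U \<and> U \<subseteq> T \<and> card U = n} = (card T - d) choose (n - d)"
proof -
  have fD: "finite D" using assms finite_subset by blast
  have "bij_betw (\<lambda>U. U - D) {U. D \<subseteq> U \<and> U \<subseteq> T \<and> card U = n} {V. V \<subseteq> T - D \<and> card V = n - d}"
  proof (rule bij_betw_byWitness[where f' = "\<lambda>V. V \<union> D"])
    show "(\<lambda>U. U - D) ` {U. D \<subseteq> U \<and> U \<subseteq> T \<and> card U = n} \<subseteq> {V. V \<subseteq> T - D \<and> card V = n - d}"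
      using assms fD by (auto simp: card_Diff_subset)
    have "card (V \<union> D) = n" if "V \<subseteq> T - D" "card V = n - d" for V
      using that assms fD card_Un_disjoint[of V D] finite_subset[of V T] by auto
    then show "(\<lambda>V. V \<union> D) ` {V. V \<subseteq> T - D \<and> card V = n - d} \<subseteq> {U. D \<subseteq> U \<and> U \<subseteq> T \<and> card U = n}"
      using assms by auto
  qed auto
  then have "card {U. D \<subseteq> U \<and> U \<subseteq> T \<and> card U = n} = card {V. V \<subseteq> T - D \<and> card V = n - d}"
    by (rule bij_betw_same_card)
  also have "\<dots> = (card T - d) choose (n - d)"
    using assms fD by (subst n_subsets) (auto simp: card_Diff_subset)
  finally show ?thesis .
qed

text \<open>Every crossing of \<open>T\<close> survives in the same number of \<open>n\<close>-subsets.\<close>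

lemma crossings_averaging:
  assumes "finite T" "4 \<le> n" "n \<le> card T"
    and y: "\<And>U. U \<subseteq> T \<Longrightarrow> card U = n \<Longrightarrow> y \<le> card (crossings U)"
  shows "y * (card T choose 4) \<le> card (crossings T) * (n choose 4)"
proof -
  define N where "N = card T"
  define pts where "pts = (\<lambda>(a, b, c, d). {a, b, c, d} :: point set)"
  define Us where "Us = {U. U \<subseteq> T \<and> card U = n}"
  have finU: "finite Us" using assms(1) by (simp add: Us_def)
  have finX: "finite (crossings T)" using assms(1) by (rule finite_crossings)
  have cU: "card (crossings U) = (\<Sum>x\<in>crossings T. of_bool (pts x \<subseteq> U))" if "U \<in> Us" for U
  proof -
    have "crossings U = {x \<in> crossings T. pts x \<subseteq> U}"
      using that by (auto simp: crossings_def pts_def Us_def)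
    then show ?thesis using finX by (simp add: of_bool_def sum.If_cases Int_def)
  qed
  have cx: "(\<Sum>U\<in>Us. of_bool (pts x \<subseteq> U)) = (N - 4) choose (n - 4)" if x: "x \<in> crossings T" for x
  proof -
    obtain a b c d where abcd: "x = (a, b, c, d)" by (cases x)
    have "card (pts x) = 4" "pts x \<subseteq> T"
      using x crossing_distinct[of a b c d] by (auto simp: abcd pts_def crossings_def)
    moreover have "(\<Sum>U\<in>Us. of_bool (pts x \<subseteq> U)) = card {U. pts x \<subseteq> U \<and> U \<subseteq> T \<and> card U = n}"
      using finU by (simp add: of_bool_def sum.If_cases Int_def) (metis (mono_tags, lifting) Us_def conj_assoc conj_commute mem_Collect_eq)
    ultimately show ?thesis
      using card_supersets[OF assms(1), of "pts x" 4 n] assms(2) by (simp add: N_def)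
  qed
  have "y * (N choose n) = (\<Sum>U\<in>Us. y)"
    using n_subsets[OF assms(1), of n] by (simp add: Us_def N_def)
  also have "\<dots> \<le> (\<Sum>U\<in>Us. card (crossings U))" by (rule sum_mono) (auto simp: Us_def intro: y)
  also have "\<dots> = (\<Sum>U\<in>Us. \<Sum>x\<in>crossings T. of_bool (pts x \<subseteq> U))" by (simp add: cU)
  also have "\<dots> = (\<Sum>x\<in>crossings T. \<Sum>U\<in>Us. of_bool (pts x \<subseteq> U))" by (rule sum.swap)
  also have "\<dots> = card (crossings T) * ((N - 4) choose (n - 4))" by (simp add: cx)
  finally have le: "y * (N choose n) \<le> card (crossings T) * ((N - 4) choose (n - 4))" .
  \<comment> \<open>Choosing \<open>n\<close> points and then four of them amounts to choosing the
    four first and completing them.\<close>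
  have "(N choose n) * (n choose 4) = (N choose 4) * ((N - 4) choose (n - 4))"
    using assms by (intro choose_mult) (auto simp: N_def)
  then have "(y * (N choose 4)) * ((N - 4) choose (n - 4)) = (y * (N choose n)) * (n choose 4)"
    by (simp add: mult.assoc)
  also have "\<dots> \<le> (card (crossings T) * (n choose 4)) * ((N - 4) choose (n - 4))"
    using mult_right_mono[OF le, of "n choose 4"] by (simp add: ac_simps)
  finally show ?thesis using assms(3) by (simp add: N_def)
qed

lemma choose_4_real: "real (n choose 4) = real n * (real n - 1) * (real n - 2) * (real n - 3) / 24"
  by (simp add: binomial_gbinomial gbinomial_prod_rev numeral_eq_Suc atLeast0_lessThan_Suc fact_numeral
      algebra_simps)

section \<open>Flattened clusters\<close>

text \<open>Positive exactly when \<open>q\<close> lies to the left of the line through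
  \<open>p\<close> directed by \<open>v\<close>.\<close>

definition side :: "point \<Rightarrow> point \<Rightarrow> point \<Rightarrow> real" where
  "side v p q = fst v * (snd q - snd p) - snd v * (fst q - fst p)"

text \<open>An affine copy of the plane around \<open>p\<close> which maps the first axis to the line through \<open>p\<close> with
  direction \<open>v\<close>; as \<open>\<delta>\<close> tends to \<open>0\<close> it shrinks, and flattens towards this line.\<close>

definition flat :: "real \<Rightarrow> point \<Rightarrow> point \<Rightarrow> point \<Rightarrow> point" where
  "flat \<delta> v p s = (fst p + \<delta> * fst s * fst v - \<delta>\<^sup>2 * snd s * snd v,
                  snd p + \<delta> * fst s * snd v + \<delta>\<^sup>2 * snd s * fst v)"

section \<open>Signs of orientations for small positive \<open>\<delta>\<close>\<close>

lemma eventually_sgn_eq: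
  fixes f :: "real \<Rightarrow> real"
  assumes "isCont f 0" "f 0 \<noteq> 0"
  shows "\<forall>\<^sub>F \<delta> in at_right 0. sgn (f \<delta>) = sgn (f 0)"
proof -
  have lim: "(f \<longlongrightarrow> f 0) (at_right 0)"
    using assms(1) by (simp add: isCont_def filterlim_at_split)
  show ?thesis
  proof (cases "f 0 > 0")
    case True
    then show ?thesis
      using order_tendstoD(1)[OF lim True] by (auto elim!: eventually_mono)
  next
    case False
    then have "f 0 < 0" using assms(2) by simp
    then show ?thesis
      using order_tendstoD(2)[OF lim, of 0] by (auto elim!: eventually_mono)
  qed
qed

text \<open>The factor is the determinant of the linear part, whose columns are
  \<open>\<delta>\<close> times \<open>v\<close> and \<open>\<delta>\<^sup>2\<close> times
  \<open>v\<close> turned by a right angle. It is positive for nonzero \<open>v\<close>, so a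
  cluster keeps the crossings of the set it copies.\<close>

lemma orient_flat_same: "orient (flat \<delta> v p s) (flat \<delta> v p t) (flat \<delta> v p u)
    = \<delta> ^ 3 * ((fst v)\<^sup>2 + (snd v)\<^sup>2) * orient s t u"
  by (simp add: orient_def flat_def algebra_simps power2_eq_square power3_eq_cube)

lemma eventually_orient_flat_distinct:
  assumes "orient p q r \<noteq> 0"
  shows "\<forall>\<^sub>F \<delta> in at_right 0.
    sgn (orient (flat \<delta> v p s) (flat \<delta> v' q t) (flat \<delta> v'' r u)) = sgn (orient p q r)"
proof -
  have "isCont (\<lambda>\<delta>. orient (flat \<delta> v p s) (flat \<delta> v' q t) (flat \<delta> v'' r u)) 0"
    by (simp add: orient_def flat_def continuous_intros)
  from eventually_sgn_eq[OF this] assms show ?thesis by (simp add: flat_def)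
qed

text \<open>At \<open>\<delta> = 0\<close> the first two points merge and the orientation vanishes,
  so its sign cannot be read off there. The quotient \<open>f\<close> by \<open>\<delta>\<close> is
  still continuous, and at 0 only the first coordinates of \<open>s\<close> and \<open>t\<close>
  survive: this is the effect of flattening.\<close>

lemma eventually_orient_flat_two:
  assumes "fst s \<noteq> fst t" "side v p q \<noteq> 0"
  shows "\<forall>\<^sub>F \<delta> in at_right 0.
    sgn (orient (flat \<delta> v p s) (flat \<delta> v p t) (flat \<delta> v' q u)) = sgn (fst t - fst s) * sgn (side v p q)"
proof -
  define f where "f = (\<lambda>\<delta>.
      ((fst t - fst s) * fst v - \<delta> * (snd t - snd s) * snd v) *
        (snd q - snd p + \<delta> * fst u * snd v' + \<delta>\<^sup>2 * snd u * fst v' - \<delta> * fst s * snd v - \<delta>\<^sup>2 * snd s * fst v)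
    - ((fst t - fst s) * snd v + \<delta> * (snd t - snd s) * fst v) *
        (fst q - fst p + \<delta> * fst u * fst v' - \<delta>\<^sup>2 * snd u * snd v' - \<delta> * fst s * fst v + \<delta>\<^sup>2 * snd s * snd v))"
  have "isCont f 0" by (simp add: f_def continuous_intros)
  moreover have "f 0 = (fst t - fst s) * side v p q"
    by (simp add: f_def side_def algebra_simps)
  ultimately have "\<forall>\<^sub>F \<delta> in at_right 0. sgn (f \<delta>) = sgn (fst t - fst s) * sgn (side v p q)"
    using eventually_sgn_eq[of f] assms by (simp add: sgn_mult)
  moreover have "\<forall>\<^sub>F \<delta> in at_right (0::real). \<delta> > 0" by (rule eventually_at_right_less)
  ultimately show ?thesis
  proof eventually_elim
    case (elim \<delta>)
    have "orient (flat \<delta> v p s) (flat \<delta> v p t) (flat \<delta> v' q u) = \<delta> * f \<delta>"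
      by (simp add: orient_def flat_def f_def algebra_simps power2_eq_square)
    with elim show ?case by (simp add: sgn_mult)
  qed
qed

lemma eventually_fst_flat_distinct:
  assumes "fst p \<noteq> fst q"
  shows "\<forall>\<^sub>F \<delta> in at_right 0. fst (flat \<delta> v p s) \<noteq> fst (flat \<delta> v' q t)"
proof -
  have "isCont (\<lambda>\<delta>. fst (flat \<delta> v p s) - fst (flat \<delta> v' q t)) 0"
    by (simp add: flat_def continuous_intros)
  from eventually_sgn_eq[OF this] show ?thesis
    using assms by (auto simp: flat_def sgn_0_0 elim!: eventually_mono)
qed

lemma eventually_fst_flat_same:
  assumes "fst s \<noteq> fst t" "fst v \<noteq> 0"
  shows "\<forall>\<^sub>F \<delta> in at_right 0. fst (flat \<delta> v p s) \<noteq> fst (flat \<delta> v p t)"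
proof -
  define f where "f = (\<lambda>\<delta>. (fst s - fst t) * fst v - \<delta> * (snd s - snd t) * snd v)"
  have "isCont f 0" by (simp add: f_def continuous_intros)
  moreover have "f 0 \<noteq> 0" using assms by (simp add: f_def)
  ultimately have "\<forall>\<^sub>F \<delta> in at_right 0. sgn (f \<delta>) = sgn (f 0)" by (rule eventually_sgn_eq)
  moreover have "\<forall>\<^sub>F \<delta> in at_right (0::real). \<delta> > 0" by (rule eventually_at_right_less)
  ultimately show ?thesis
  proof eventually_elim
    case (elim \<delta>)
    have "fst (flat \<delta> v p s) - fst (flat \<delta> v p t) = \<delta> * f \<delta>"
      by (simp add: flat_def f_def algebra_simps power2_eq_square)
    moreover have "f \<delta> \<noteq> 0" using elim(1) \<open>f 0 \<noteq> 0\<close> by (metis sgn_0_0)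
    ultimately show ?case using elim by auto
  qed
qed

text \<open>A vertical direction is excluded by \<open>fst_v\<close> since abscissae inside such a
  cluster would differ only through second coordinates, which may coincide. By
  \<open>side_pt\<close> every other point lies strictly on one side of the line at a point.\<close>

locale configuration =
  fixes I :: "'i set" and pt :: "'i \<Rightarrow> point" and v :: "'i \<Rightarrow> point"
  assumes fin_I: "finite I"
    and fst_pt: "\<And>i j. i \<in> I \<Longrightarrow> j \<in> I \<Longrightarrow> i \<noteq> j \<Longrightarrow> fst (pt i) \<noteq> fst (pt j)"
    and orient_pt: "\<And>i j k. i \<in> I \<Longrightarrow> j \<in> I \<Longrightarrow> k \<in> I \<Longrightarrow> i \<noteq> j \<Longrightarrow> i \<noteq> k \<Longrightarrow> j \<noteq> k \<Longrightarrow>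
      orient (pt i) (pt j) (pt k) \<noteq> 0"
    and fst_v: "\<And>i. i \<in> I \<Longrightarrow> fst (v i) \<noteq> 0"
    and side_pt: "\<And>i j. i \<in> I \<Longrightarrow> j \<in> I \<Longrightarrow> i \<noteq> j \<Longrightarrow> side (v i) (pt i) (pt j) \<noteq> 0"

text \<open>One \<open>\<delta>\<close> is fixed together with the sign rules that hold for all
  small values, so that the counting below is free of limits.\<close>

locale substitution = configuration I pt v
  for I :: "'i set" and pt v +
  fixes S :: "'i \<Rightarrow> point set" and \<delta> :: real
  assumes S: "\<And>i. i \<in> I \<Longrightarrow> generic (S i)"
    and \<delta>: "\<delta> > 0"
    and orient_distinct: "\<And>p q r s t u. p \<in> I \<Longrightarrow> q \<in> I \<Longrightarrow> r \<in> I \<Longrightarrow> s \<in> S p \<Longrightarrow> t \<in> S q \<Longrightarrow> u \<in> S r \<Longrightarrow>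
      p \<noteq> q \<Longrightarrow> p \<noteq> r \<Longrightarrow> q \<noteq> r \<Longrightarrow>
      sgn (orient (flat \<delta> (v p) (pt p) s) (flat \<delta> (v q) (pt q) t) (flat \<delta> (v r) (pt r) u))
        = sgn (orient (pt p) (pt q) (pt r))"
    and orient_two: "\<And>p q s t u. p \<in> I \<Longrightarrow> q \<in> I \<Longrightarrow> s \<in> S p \<Longrightarrow> t \<in> S p \<Longrightarrow> u \<in> S q \<Longrightarrow> p \<noteq> q \<Longrightarrow>
      sgn (orient (flat \<delta> (v p) (pt p) s) (flat \<delta> (v p) (pt p) t) (flat \<delta> (v q) (pt q) u))
        = sgn (fst t - fst s) * sgn (side (v p) (pt p) (pt q))"
    and fst_flat: "\<And>p q s t. p \<in> I \<Longrightarrow> q \<in> I \<Longrightarrow> s \<in> S p \<Longrightarrow> t \<in> S q \<Longrightarrow> (p, s) \<noteq> (q, t) \<Longrightarrow>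
      fst (flat \<delta> (v p) (pt p) s) \<noteq> fst (flat \<delta> (v q) (pt q) t)"

text \<open>The clusters are finite, so finitely many eventually valid sign conditions hold
  simultaneously.\<close>

lemma (in configuration) exists_substitution:
  assumes S: "\<And>i. i \<in> I \<Longrightarrow> generic (S i)"
  obtains \<delta> where "substitution I pt v S \<delta>"
proof -
  define A where "A = Sigma I S"
  have fin: "finite A" and inj: "\<And>i. i \<in> I \<Longrightarrow> inj_on fst (S i)"
    using S fin_I by (auto simp: generic_def A_def)
  have "\<forall>\<^sub>F \<delta> in at_right 0. \<forall>x\<in>A. \<forall>y\<in>A. \<forall>z\<in>A. case (x, y, z) of ((p, s), (q, t), (r, u)) \<Rightarrow>
      p \<noteq> q \<longrightarrow> p \<noteq> r \<longrightarrow> q \<noteq> r \<longrightarrow>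
      sgn (orient (flat \<delta> (v p) (pt p) s) (flat \<delta> (v q) (pt q) t) (flat \<delta> (v r) (pt r) u))
        = sgn (orient (pt p) (pt q) (pt r))"
    using orient_pt
    by (intro eventually_ball_finite ballI) (auto simp: A_def fin[unfolded A_def] intro!: eventually_orient_flat_distinct)
  moreover have "\<forall>\<^sub>F \<delta> in at_right 0. \<forall>x\<in>A. \<forall>y\<in>A. \<forall>z\<in>A. case (x, y, z) of ((p, s), (p', t), (q, u)) \<Rightarrow>
      p = p' \<longrightarrow> p \<noteq> q \<longrightarrow>
      sgn (orient (flat \<delta> (v p) (pt p) s) (flat \<delta> (v p) (pt p) t) (flat \<delta> (v q) (pt q) u))
        = sgn (fst t - fst s) * sgn (side (v p) (pt p) (pt q))"
  proof (intro eventually_ball_finite ballI, goal_cases)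
    case (4 x y z)
    then obtain p s p' t q u where xyz: "x = (p, s)" "y = (p', t)" "z = (q, u)" "p \<in> I" "q \<in> I" "s \<in> S p" "t \<in> S p'"
      by (auto simp: A_def)
    show ?case
    \<comment> \<open>For \<open>s = t\<close> both sides are 0; otherwise genericity of
      \<open>S p\<close> separates the abscissae.\<close>
    proof (cases "p = p' \<and> p \<noteq> q \<and> s \<noteq> t")
      case True
      then have "fst s \<noteq> fst t" using xyz inj_onD[OF inj, of p s t] by auto
      then show ?thesis
        using eventually_orient_flat_two[of s t "v p" "pt p" "pt q"] side_pt[of p q] xyz True by simp
    qed (auto simp: xyz)
  qed (auto simp: fin)
  moreover have "\<forall>\<^sub>F \<delta> in at_right 0. \<forall>x\<in>A. \<forall>y\<in>A. case (x, y) of ((p, s), (q, t)) \<Rightarrow>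
      (p, s) \<noteq> (q, t) \<longrightarrow> fst (flat \<delta> (v p) (pt p) s) \<noteq> fst (flat \<delta> (v q) (pt q) t)"
  proof (intro eventually_ball_finite ballI, goal_cases)
    case (3 x y)
    then obtain p s q t where xy: "x = (p, s)" "y = (q, t)" "p \<in> I" "q \<in> I" "s \<in> S p" "t \<in> S q"
      by (auto simp: A_def)
    show ?case
    proof (cases "p = q")
      case True
      then show ?thesis
        using eventually_fst_flat_same[of s t "v p" "pt p"] fst_v[of p] xy inj_onD[OF inj, of p s t]
        by (cases "s = t") auto
    next
      case False
      then show ?thesis
        using eventually_fst_flat_distinct[of "pt p" "pt q" "v p" s "v q" t] xy fst_pt[of p q] by auto
    qed
  qed (auto simp: fin)
  moreover have "\<forall>\<^sub>F \<delta> in at_right (0::real). \<delta> > 0" by (rule eventually_at_right_less)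
  ultimately have "\<forall>\<^sub>F \<delta> in at_right 0. substitution I pt v S \<delta>"
  proof eventually_elim
    case (elim \<delta>)
    show ?case
    proof (unfold_locales, goal_cases)
      case (3 p q r s t u)
      then show ?case using elim(1) by (fastforce simp: A_def)
    next
      case (4 p q s t u)
      then show ?case using elim(2) by (fastforce simp: A_def)
    next
      case (5 p q s t)
      then show ?case using elim(3) by (fastforce simp: A_def)
    qed (use elim(4) S in auto)
  qed
  then obtain \<delta> where "substitution I pt v S \<delta>"
    using eventually_happens[of "substitution I pt v S" "at_right 0"] by auto
  with that show ?thesis .
qed

section \<open>Counting crossings by clusters\<close>

lemma crossing_sgn:
  "crossing a b c d \<longleftrightarrow> sgn (orient a b c) * sgn (orient a b d) < 0 \<and> sgn (orient c d a) * sgn (orient c d b) < 0"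
  unfolding crossing_def by (simp flip: sgn_mult)

lemma twice_card_less_pairs:
  assumes "finite S"
  shows "2 * card {(s, u). s \<in> S \<and> u \<in> S \<and> fst s < (fst u :: real)} \<le> card S ^ 2"
proof -
  let ?A = "{(s, u). s \<in> S \<and> u \<in> S \<and> fst s < (fst u :: real)}"
  have sub: "?A \<subseteq> S \<times> S" by auto
  then have fin: "finite ?A" using assms finite_subset by blast
  have "card (prod.swap ` ?A) = card ?A" by (intro card_image) simp
  then have "2 * card ?A = card (?A \<union> prod.swap ` ?A)"
    using fin by (subst card_Un_disjoint) auto
  also have "\<dots> \<le> card (S \<times> S)" using assms sub by (intro card_mono) auto
  finally show ?thesis by (simp add: card_cartesian_product power2_eq_square)
qed

definition mid_triples :: "point set \<Rightarrow> (point \<times> point \<times> point) set" where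
  "mid_triples S = {(s, t, u). s \<in> S \<and> t \<in> S \<and> u \<in> S \<and> (fst u - fst s) * (fst u - fst t) < 0}"

text \<open>Of three numbers at most one lies strictly between the other two.\<close>

lemma three_card_mid_triples:
  assumes "finite S" shows "3 * card (mid_triples S) \<le> card S ^ 3"
proof -
  let ?f = "\<lambda>(s, t, u). (t, u, s)" and ?g = "\<lambda>(s, t, u). (u, s, t)"
  have sub: "mid_triples S \<subseteq> S \<times> S \<times> S" by (auto simp: mid_triples_def)
  then have fin: "finite (mid_triples S)" using assms finite_subset by blast
  have c: "card (?f ` mid_triples S) = card (mid_triples S)" "card (?g ` mid_triples S) = card (mid_triples S)"
    by (auto intro!: card_image inj_onI)
  have "mid_triples S \<inter> ?f ` mid_triples S = {}"
    by (auto simp: mid_triples_def mult_less_0_iff)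
  moreover have "(mid_triples S \<union> ?f ` mid_triples S) \<inter> ?g ` mid_triples S = {}"
    by (auto simp: mid_triples_def mult_less_0_iff)
  ultimately have "3 * card (mid_triples S) = card (mid_triples S \<union> ?f ` mid_triples S \<union> ?g ` mid_triples S)"
    using fin c by (subst card_Un_disjoint card_Un_disjoint | simp)+
  also have "\<dots> \<le> card (S \<times> S \<times> S)" using assms by (intro card_mono) (auto simp: mid_triples_def)
  finally show ?thesis by (simp add: card_cartesian_product power3_eq_cube mult.assoc)
qed

text \<open>Here \<open>u\<close> lies below the segment from \<open>s\<close> to \<open>t\<close>,
  so that an edge from \<open>u\<close> to a point far above crosses it;
  \<open>lower_triples\<close> is the mirror image.\<close>

definition upper_triples :: "point set \<Rightarrow> (point \<times> point \<times> point) set" where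
  "upper_triples S = {(s, t, u) \<in> mid_triples S. orient s t u * (fst t - fst s) < 0}"

definition lower_triples :: "point set \<Rightarrow> (point \<times> point \<times> point) set" where
  "lower_triples S = {(s, t, u) \<in> mid_triples S. orient s t u * (fst t - fst s) > 0}"

lemma card_upper_lower_triples:
  assumes "finite S" shows "3 * (card (upper_triples S) + card (lower_triples S)) \<le> card S ^ 3"
proof -
  have fin: "finite (mid_triples S)"
    by (rule finite_subset[of _ "S \<times> S \<times> S"]) (auto simp: mid_triples_def assms)
  have "upper_triples S \<subseteq> mid_triples S" "lower_triples S \<subseteq> mid_triples S" by (auto simp: upper_triples_def lower_triples_def)
  then have "card (upper_triples S) + card (lower_triples S) = card (upper_triples S \<union> lower_triples S)"
    using fin finite_subset by (subst card_Un_disjoint) (auto simp: upper_triples_def lower_triples_def)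
  also have "\<dots> \<le> card (mid_triples S)"
    using fin by (intro card_mono) (auto simp: upper_triples_def lower_triples_def)
  finally have "3 * (card (upper_triples S) + card (lower_triples S)) \<le> 3 * card (mid_triples S)"
    by (rule mult_le_mono2)
  also note three_card_mid_triples[OF assms]
  finally show ?thesis .
qed

section \<open>Crossings according to the clusters of their end points\<close>

context substitution
begin

abbreviation emb :: "'i \<Rightarrow> point \<Rightarrow> point" where
  "emb p s \<equiv> flat \<delta> (v p) (pt p) s"

abbreviation sd :: "'i \<Rightarrow> 'i \<Rightarrow> real" where
  "sd p q \<equiv> side (v p) (pt p) (pt q)"

abbreviation ori :: "'i \<Rightarrow> 'i \<Rightarrow> 'i \<Rightarrow> real" where
  "ori p q r \<equiv> orient (pt p) (pt q) (pt r)"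

abbreviation sz :: "'i \<Rightarrow> nat" where
  "sz p \<equiv> card (S p)"

definition T :: "point set" where
  "T = (\<lambda>(p, s). emb p s) ` Sigma I S"

definition mixed :: "'i \<Rightarrow> 'i \<Rightarrow> 'i \<Rightarrow> 'i \<Rightarrow> (point \<times> point \<times> point \<times> point) set" where
  "mixed p q r w = {(s, t, u, x). s \<in> S p \<and> t \<in> S q \<and> u \<in> S r \<and> x \<in> S w \<and>
     crossing (emb p s) (emb q t) (emb r u) (emb w x)}"

lemma fin_S: "p \<in> I \<Longrightarrow> finite (S p)"
  using S by (auto simp: generic_def)

lemma inj_emb: "inj_on (\<lambda>(p, s). emb p s) (Sigma I S)"
proof (rule inj_onI, clarify)
  fix p s q t
  assume *: "p \<in> I" "s \<in> S p" "q \<in> I" "t \<in> S q" "emb p s = emb q t"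
  then show "p = q \<and> s = t" using fst_flat[of p q s t] by auto
qed

lemma card_T: "card T = (\<Sum>p\<in>I. sz p)"
  unfolding T_def using card_image[OF inj_emb] fin_I fin_S by simp

lemma mixed_subset: "mixed p q r w \<subseteq> S p \<times> S q \<times> S r \<times> S w"
  by (auto simp: mixed_def)

lemma finite_mixed: "p \<in> I \<Longrightarrow> q \<in> I \<Longrightarrow> r \<in> I \<Longrightarrow> w \<in> I \<Longrightarrow> finite (mixed p q r w)"
  using mixed_subset[of p q r w] by (rule finite_subset) (simp add: fin_S)

lemma v_norm: "p \<in> I \<Longrightarrow> (fst (v p))\<^sup>2 + (snd (v p))\<^sup>2 > 0"
  using fst_v[of p] by (simp add: sum_power2_gt_zero_iff)

lemma sgn_orient_same:
  "p \<in> I \<Longrightarrow> sgn (orient (emb p s) (emb p t) (emb p u)) = sgn (orient s t u)"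
  using \<delta> v_norm[of p] by (simp add: orient_flat_same sgn_mult)

text \<open>Three points of one cluster inherit non-collinearity from \<open>S p\<close>; for two
  points in one cluster it follows from \<open>side_pt\<close>, and for three different clusters
  from \<open>orient_pt\<close>.\<close>

lemma generic_T: "generic T"
proof -
  have inj: "inj_on fst T"
  proof (rule inj_onI)
    fix a b assume ab: "a \<in> T" "b \<in> T" "fst a = fst b"
    then obtain p s q t where "a = emb p s" "b = emb q t" "p \<in> I" "q \<in> I" "s \<in> S p" "t \<in> S q"
      by (auto simp: T_def)
    with ab(3) show "a = b" using fst_flat[of p q s t] by auto
  qed
  have two: "orient (emb p s) (emb p t) (emb q u) \<noteq> 0"
    if "p \<in> I" "q \<in> I" "p \<noteq> q" "s \<in> S p" "t \<in> S p" "u \<in> S q" "s \<noteq> t" for p q s t u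
  proof -
    have "fst s \<noteq> fst t" using that S[of p] by (auto simp: generic_def dest: inj_onD)
    then have "sgn (orient (emb p s) (emb p t) (emb q u)) \<noteq> 0"
      using orient_two[of p q s t u] side_pt[of p q] that by (simp add: sgn_0_0)
    then show ?thesis by (simp add: sgn_0_0)
  qed
  have all: "orient (emb p s) (emb q t) (emb r u) \<noteq> 0"
    if *: "p \<in> I" "q \<in> I" "r \<in> I" "s \<in> S p" "t \<in> S q" "u \<in> S r"
      "(p, s) \<noteq> (q, t)" "(p, s) \<noteq> (r, u)" "(q, t) \<noteq> (r, u)" for p q r s t u
  proof -
    consider "p = q" "q = r" | "p = q" "q \<noteq> r" | "p = r" "p \<noteq> q" | "q = r" "p \<noteq> q"
      | "p \<noteq> q" "p \<noteq> r" "q \<noteq> r" by blast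
    then show ?thesis
    proof cases
      case 1
      then have "orient s t u \<noteq> 0" using S[of p] * by (auto simp: generic_def)
      then show ?thesis using sgn_orient_same[of p s t u] 1 *(1) by (metis sgn_0_0)
    next
      case 2
      then show ?thesis using two[of p r s t u] * by auto
    next
      case 3
      then show ?thesis using two[of p q u s t] * orient_rotate[of "emb p u" "emb p s" "emb q t"] by auto
    next
      case 4
      then show ?thesis using two[of q p t u s] * orient_rotate[of "emb p s" "emb q t" "emb q u"] by auto
    next
      case 5
      then have "ori p q r \<noteq> 0" using orient_pt[of p q r] * by auto
      then show ?thesis using orient_distinct[of p q r s t u] 5 * by (metis sgn_0_0)
    qed
  qed
  have "orient a b c \<noteq> 0" if abc: "a \<in> T" "b \<in> T" "c \<in> T" "a \<noteq> b" "a \<noteq> c" "b \<noteq> c" for a b c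
  proof -
    obtain p s q t r u where eq: "a = emb p s" "b = emb q t" "c = emb r u"
      and "p \<in> I" "q \<in> I" "r \<in> I" "s \<in> S p" "t \<in> S q" "u \<in> S r"
      using abc(1-3) unfolding T_def by auto
    moreover have "(p, s) \<noteq> (q, t)" "(p, s) \<noteq> (r, u)" "(q, t) \<noteq> (r, u)" using abc(4-6) eq by auto
    ultimately show ?thesis using all by simp
  qed
  moreover have "finite T" using fin_I fin_S by (simp add: T_def)
  ultimately show ?thesis using inj unfolding generic_def by blast
qed

lemma card_crossings_T_le:
  "card (crossings T) \<le> (\<Sum>p\<in>I. \<Sum>q\<in>I. \<Sum>r\<in>I. \<Sum>w\<in>I. card (mixed p q r w))"
proof -
  let ?g = "\<lambda>p q r w (s, t, u, x). (emb p s, emb q t, emb r u, emb w x)"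
  have "crossings T \<subseteq> (\<Union>(p, q, r, w)\<in>I \<times> I \<times> I \<times> I. ?g p q r w ` mixed p q r w)" (is "_ \<subseteq> ?U")
  proof
    fix z assume "z \<in> crossings T"
    then obtain p s q t r u w x where "z = (emb p s, emb q t, emb r u, emb w x)"
      "crossing (emb p s) (emb q t) (emb r u) (emb w x)"
      "p \<in> I" "q \<in> I" "r \<in> I" "w \<in> I" "s \<in> S p" "t \<in> S q" "u \<in> S r" "x \<in> S w"
      by (auto simp: crossings_def T_def)
    then have "(p, q, r, w) \<in> I \<times> I \<times> I \<times> I" "z \<in> ?g p q r w ` mixed p q r w"
      by (auto simp: mixed_def intro!: rev_image_eqI[of "(s, t, u, x)"])
    then show "z \<in> ?U" by blast
  qed
  then have "card (crossings T) \<le> card ?U"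
    using fin_I finite_mixed by (intro card_mono) auto
  also have "\<dots> \<le> (\<Sum>(p, q, r, w)\<in>I \<times> I \<times> I \<times> I. card (?g p q r w ` mixed p q r w))"
    using card_UN_le[of "I \<times> I \<times> I \<times> I" "\<lambda>(p, q, r, w). ?g p q r w ` mixed p q r w"] fin_I
    by (simp add: case_prod_unfold)
  also have "\<dots> \<le> (\<Sum>(p, q, r, w)\<in>I \<times> I \<times> I \<times> I. card (mixed p q r w))"
    by (intro sum_mono) (auto intro: card_image_le finite_mixed)
  also have "\<dots> = (\<Sum>p\<in>I. \<Sum>q\<in>I. \<Sum>r\<in>I. \<Sum>w\<in>I. card (mixed p q r w))"
    by (simp add: sum.cartesian_product case_prod_unfold)
  finally show ?thesis .
qed

lemma card_mixed_sym:
  "card (mixed q p r w) = card (mixed p q r w)"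
  "card (mixed p q w r) = card (mixed p q r w)"
  "card (mixed r w p q) = card (mixed p q r w)"
proof -
  have "bij_betw (\<lambda>(s, t, u, x). (t, s, u, x)) (mixed q p r w) (mixed p q r w)"
    by (rule bij_betw_byWitness[where f' = "\<lambda>(s, t, u, x). (t, s, u, x)"])
      (auto simp: mixed_def crossing_sym)
  then show "card (mixed q p r w) = card (mixed p q r w)" by (rule bij_betw_same_card)
  have "bij_betw (\<lambda>(s, t, u, x). (s, t, x, u)) (mixed p q w r) (mixed p q r w)"
    by (rule bij_betw_byWitness[where f' = "\<lambda>(s, t, u, x). (s, t, x, u)"])
      (auto simp: mixed_def crossing_sym)
  then show "card (mixed p q w r) = card (mixed p q r w)" by (rule bij_betw_same_card)
  have "bij_betw (\<lambda>(s, t, u, x). (u, x, s, t)) (mixed r w p q) (mixed p q r w)"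
    by (rule bij_betw_byWitness[where f' = "\<lambda>(s, t, u, x). (u, x, s, t)"])
      (auto simp: mixed_def crossing_sym)
  then show "card (mixed r w p q) = card (mixed p q r w)" by (rule bij_betw_same_card)
qed

lemma card_mixed_distinct:
  assumes "p \<in> I" "q \<in> I" "r \<in> I" "w \<in> I" "distinct [p, q, r, w]"
  shows "card (mixed p q r w) \<le> sz p * sz q * sz r * sz w * of_bool (crossing (pt p) (pt q) (pt r) (pt w))"
proof -
  have "mixed p q r w \<subseteq> (if crossing (pt p) (pt q) (pt r) (pt w) then S p \<times> S q \<times> S r \<times> S w else {})"
  proof clarify
    fix s t u x assume "(s, t, u, x) \<in> mixed p q r w"
    then have *: "s \<in> S p" "t \<in> S q" "u \<in> S r" "x \<in> S w" "crossing (emb p s) (emb q t) (emb r u) (emb w x)"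
      by (auto simp: mixed_def)
    then have "crossing (pt p) (pt q) (pt r) (pt w)"
      using orient_distinct[of p q r s t u] orient_distinct[of p q w s t x]
        orient_distinct[of r w p u x s] orient_distinct[of r w q u x t] assms
      by (auto simp: crossing_sgn)
    with * show "(s, t, u, x) \<in> (if crossing (pt p) (pt q) (pt r) (pt w) then S p \<times> S q \<times> S r \<times> S w else {})" by simp
  qed
  then have "card (mixed p q r w) \<le> card (if crossing (pt p) (pt q) (pt r) (pt w) then S p \<times> S q \<times> S r \<times> S w else {})"
    using assms fin_S by (intro card_mono) auto
  then show ?thesis by (simp add: card_cartesian_product mult.assoc split: if_splits)
qed

text \<open>A line through two points outside the cluster of \<open>p\<close> has the whole cluster
  on one side, so it cannot separate the two ends of an edge inside the cluster.\<close>

lemma mixed_edge_in_cluster: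
  assumes "p \<in> I" "r \<in> I" "w \<in> I" "r \<noteq> p" "w \<noteq> p"
  shows "mixed p p r w = {}"
proof -
  have False if "(s, t, u, x) \<in> mixed p p r w" for s t u x
  proof -
    have *: "s \<in> S p" "t \<in> S p" "u \<in> S r" "x \<in> S w" "crossing (emb p s) (emb p t) (emb r u) (emb w x)"
      using that by (auto simp: mixed_def)
    have "sgn (orient (emb r u) (emb w x) (emb p s)) = sgn (orient (emb r u) (emb w x) (emb p t))"
      using orient_distinct[of r w p u x s] orient_distinct[of r w p u x t]
        orient_two[of r p u x s] orient_two[of r p u x t] assms * by (cases "r = w") auto
    moreover have "\<not> sgn y * sgn y < 0" for y :: real by (simp add: sgn_if)
    ultimately show False using *(5) unfolding crossing_sgn by metis
  qed
  then show ?thesis by auto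
qed

text \<open>Edges from \<open>s\<close> to cluster \<open>q\<close> and from \<open>u\<close> to
  cluster \<open>w\<close> cross only if \<open>q\<close> and \<open>w\<close> lie on the same side
  of the line at \<open>p\<close> and \<open>s\<close>, \<open>u\<close> come in one particular
  order along it. That order, given by the sign of \<open>\<tau>\<close>, leaves at most half of the
  pairs.\<close>

lemma card_mixed_two_in_cluster:
  assumes "p \<in> I" "q \<in> I" "w \<in> I" "distinct [p, q, w]"
  shows "2 * card (mixed p q p w) \<le> sz p ^ 2 * (sz q * sz w) * of_bool (sd p q * sd p w > 0)"
proof -
  let ?L = "{(s, u). s \<in> S p \<and> u \<in> S p \<and> fst s < fst u}"
  define \<tau> where "\<tau> = sd p q * ori p q w"
  have key: "\<tau> * (fst s - fst u) < 0 \<and> sd p q * sd p w > 0"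
    if "(s, t, u, x) \<in> mixed p q p w" for s t u x
  proof -
    have *: "s \<in> S p" "t \<in> S q" "u \<in> S p" "x \<in> S w" "crossing (emb p s) (emb q t) (emb p u) (emb w x)"
      using that by (auto simp: mixed_def)
    have 1: "sgn (orient (emb p s) (emb q t) (emb p u)) = sgn (fst s - fst u) * sgn (sd p q)"
      using orient_two[of p q u s t] orient_rotate[of "emb p u" "emb p s" "emb q t"] assms * by simp
    have 2: "sgn (orient (emb p u) (emb w x) (emb p s)) = sgn (fst u - fst s) * sgn (sd p w)"
      using orient_two[of p w s u x] orient_rotate[of "emb p s" "emb p u" "emb w x"] assms * by simp
    have 3: "sgn (orient (emb p s) (emb q t) (emb w x)) = sgn (ori p q w)"
      "sgn (orient (emb p u) (emb w x) (emb q t)) = sgn (ori p w q)"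
      using orient_distinct[of p q w s t x] orient_distinct[of p w q u x t] assms * by auto
    \<comment> \<open>This sign change makes the two crossing conditions compatible only when
      \<open>sd p q\<close> and \<open>sd p w\<close> have equal signs.\<close>
    have 4: "ori p w q = - ori p q w" by (simp add: orient_def algebra_simps)
    have "(fst s - fst u) * sd p q * ori p q w < 0"
      "(fst u - fst s) * sd p w * ori p w q < 0"
      using *(5) unfolding crossing_sgn 1 2 3 by (simp_all flip: sgn_mult)
    then show ?thesis unfolding 4 \<tau>_def
      by (auto simp: mult_less_0_iff zero_less_mult_iff)
  qed
  show ?thesis
  proof (cases "sd p q * sd p w > 0")
    case False
    then have "mixed p q p w = {}" using key by auto
    then show ?thesis by simp
  next
    case True
    \<comment> \<open>\<open>?h\<close> puts the pair from cluster \<open>p\<close> in increasing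
      order; as \<open>\<tau>\<close> is fixed, the original order can be recovered.\<close>
    let ?h = "\<lambda>(s, t, u, x). (if \<tau> > 0 then (s, u) else (u, s), t, x)"
    have "inj_on ?h (mixed p q p w)" by (auto simp: inj_on_def split: if_splits)
    moreover have "?h ` mixed p q p w \<subseteq> ?L \<times> S q \<times> S w"
    proof (rule image_subsetI)
      fix y assume "y \<in> mixed p q p w"
      then obtain s t u x where a: "y = (s, t, u, x)" "(s, t, u, x) \<in> mixed p q p w" by (cases y) auto
      then have "s \<in> S p" "t \<in> S q" "u \<in> S p" "x \<in> S w" by (auto simp: mixed_def)
      then show "?h y \<in> ?L \<times> S q \<times> S w"
        using key[OF a(2)] by (auto simp: a(1) mult_less_0_iff)
    qed
    moreover have "finite (?L \<times> S q \<times> S w)"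
      by (rule finite_subset[of _ "(S p \<times> S p) \<times> S q \<times> S w"]) (auto simp: fin_S assms)
    ultimately have "card (mixed p q p w) \<le> card (?L \<times> S q \<times> S w)" by (rule card_inj_on_le)
    then have "2 * card (mixed p q p w) \<le> (2 * card ?L) * (sz q * sz w)"
      by (simp add: card_cartesian_product)
    also have "\<dots> \<le> sz p ^ 2 * (sz q * sz w)"
      using twice_card_less_pairs[OF fin_S[OF assms(1)]] by (intro mult_right_mono) auto
    finally show ?thesis using True by simp
  qed
qed

text \<open>Exchanging \<open>s\<close> and \<open>u\<close> reverses the sign in
  \<open>key\<close>, so at most one of the two quadruples is a crossing.\<close>

lemma card_mixed_two_clusters:
  assumes "p \<in> I" "q \<in> I" "p \<noteq> q"
  shows "2 * card (mixed p q p q) \<le> sz p ^ 2 * sz q ^ 2"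
proof -
  define \<tau> where "\<tau> = sd p q * sd q p"
  have key: "\<tau> * (fst s - fst u) * (fst x - fst t) < 0" if "(s, t, u, x) \<in> mixed p q p q" for s t u x
  proof -
    have *: "s \<in> S p" "t \<in> S q" "u \<in> S p" "x \<in> S q" "crossing (emb p s) (emb q t) (emb p u) (emb q x)"
      using that by (auto simp: mixed_def)
    have 1: "sgn (orient (emb p s) (emb q t) (emb p u)) = sgn (fst s - fst u) * sgn (sd p q)"
      using orient_two[of p q u s t] orient_rotate[of "emb p u" "emb p s" "emb q t"] assms * by simp
    have 2: "sgn (orient (emb p s) (emb q t) (emb q x)) = sgn (fst x - fst t) * sgn (sd q p)"
      using orient_two[of q p t x s] orient_rotate[of "emb p s" "emb q t" "emb q x"] assms * by simp
    have "(fst s - fst u) * sd p q * ((fst x - fst t) * sd q p) < 0"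
      using *(5) unfolding crossing_sgn 1 2 by (simp flip: sgn_mult)
    then show ?thesis by (simp add: \<tau>_def ac_simps)
  qed
  note sub = mixed_subset[of p q p q]
  let ?f = "\<lambda>(s, t, u, x). (u, t, s, x)"
  have c: "card (?f ` mixed p q p q) = card (mixed p q p q)"
    by (auto intro!: card_image inj_onI)
  have "mixed p q p q \<inter> ?f ` mixed p q p q = {}"
  proof -
    have False if "(s, t, u, x) \<in> mixed p q p q" "(u, t, s, x) \<in> mixed p q p q" for s t u x
      using key[OF that(1)] key[OF that(2)] by (auto simp: mult_less_0_iff zero_less_mult_iff)
    then show ?thesis by auto
  qed
  then have "2 * card (mixed p q p q) = card (mixed p q p q \<union> ?f ` mixed p q p q)"
    using c finite_mixed assms by (subst card_Un_disjoint) auto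
  also have "\<dots> \<le> card (S p \<times> S q \<times> S p \<times> S q)"
    using assms fin_S sub by (intro card_mono) auto
  finally show ?thesis by (simp add: card_cartesian_product power2_eq_square ac_simps)
qed

text \<open>Seen from the cluster of \<open>p\<close>, all points of cluster \<open>w\<close> lie
  far above or far below. An edge from \<open>u\<close> to them meets the edge from \<open>s\<close>
  to \<open>t\<close> only if \<open>u\<close> is between \<open>s\<close> and \<open>t\<close>
  along the line and on the opposite side of that edge.\<close>

lemma card_mixed_three_in_cluster:
  assumes "p \<in> I" "w \<in> I" "p \<noteq> w"
  shows "card (mixed p p p w) \<le> sz w * (if sd p w > 0 then card (upper_triples (S p)) else card (lower_triples (S p)))"
proof -
  let ?A = "if sd p w > 0 then upper_triples (S p) else lower_triples (S p)"
  have key: "(s, t, u) \<in> ?A" if "(s, t, u, x) \<in> mixed p p p w" for s t u x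
  proof -
    have *: "s \<in> S p" "t \<in> S p" "u \<in> S p" "x \<in> S w" "crossing (emb p s) (emb p t) (emb p u) (emb w x)"
      using that by (auto simp: mixed_def)
    have 1: "sgn (orient (emb p s) (emb p t) (emb w x)) = sgn (fst t - fst s) * sgn (sd p w)"
      using orient_two[of p w s t x] assms * by simp
    have 2: "sgn (orient (emb p u) (emb w x) (emb p s)) = sgn (fst u - fst s) * sgn (sd p w)"
      using orient_two[of p w s u x] orient_rotate[of "emb p s" "emb p u" "emb w x"] assms * by simp
    have 3: "sgn (orient (emb p u) (emb w x) (emb p t)) = sgn (fst u - fst t) * sgn (sd p w)"
      using orient_two[of p w t u x] orient_rotate[of "emb p t" "emb p u" "emb w x"] assms * by simp
    have "orient s t u * ((fst t - fst s) * sd p w) < 0"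
      "((fst u - fst s) * sd p w) * ((fst u - fst t) * sd p w) < 0"
      using *(5) assms(1) unfolding crossing_sgn 1 2 3 by (simp_all add: sgn_orient_same flip: sgn_mult)
    then show ?thesis using * side_pt[of p w] assms
      by (auto simp: upper_triples_def lower_triples_def mid_triples_def mult_less_0_iff zero_less_mult_iff)
  qed
  have "finite (mid_triples (S p))"
    by (rule finite_subset[of _ "S p \<times> S p \<times> S p"]) (auto simp: mid_triples_def fin_S assms)
  then have finA: "finite ?A"
    by (rule rev_finite_subset) (auto simp: upper_triples_def lower_triples_def)
  let ?g = "\<lambda>(s, t, u, x). ((s, t, u), x)"
  have "inj_on ?g (mixed p p p w)" by (auto simp: inj_on_def)
  moreover have "?g ` mixed p p p w \<subseteq> ?A \<times> S w"
  proof (rule image_subsetI)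
    fix y assume "y \<in> mixed p p p w"
    then obtain s t u x where a: "y = (s, t, u, x)" "(s, t, u, x) \<in> mixed p p p w" by (cases y) auto
    then have "x \<in> S w" by (simp add: mixed_def)
    then show "?g y \<in> ?A \<times> S w" using key[OF a(2)] by (simp add: a(1))
  qed
  moreover have "finite (?A \<times> S w)" using finA fin_S assms by simp
  ultimately have "card (mixed p p p w) \<le> card (?A \<times> S w)" by (rule card_inj_on_le)
  then show ?thesis by (simp add: card_cartesian_product mult.commute split: if_splits)
qed

lemma card_mixed_one_cluster:
  assumes "p \<in> I" shows "card (mixed p p p p) \<le> card (crossings (S p))"
proof -
  have "mixed p p p p \<subseteq> crossings (S p)"
    using sgn_orient_same[OF assms] by (auto simp: mixed_def crossings_def crossing_sgn)
  then show ?thesis using finite_crossings[OF fin_S[OF assms]] by (rule card_mono[rotated])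
qed

end

section \<open>Summation over all cluster patterns\<close>

lemma sum4_delta:
  fixes f :: "'i \<Rightarrow> 'i \<Rightarrow> 'i \<Rightarrow> real"
  assumes "finite I"
  shows "(\<Sum>p\<in>I. \<Sum>q\<in>I. \<Sum>r\<in>I. \<Sum>w\<in>I. if p = r then f p q w else 0) = (\<Sum>p\<in>I. \<Sum>q\<in>I. \<Sum>r\<in>I. f p q r)" (is ?A)
    and "(\<Sum>p\<in>I. \<Sum>q\<in>I. \<Sum>r\<in>I. \<Sum>w\<in>I. if p = w then f p q r else 0) = (\<Sum>p\<in>I. \<Sum>q\<in>I. \<Sum>r\<in>I. f p q r)" (is ?B)
    and "(\<Sum>p\<in>I. \<Sum>q\<in>I. \<Sum>r\<in>I. \<Sum>w\<in>I. if q = r then f q p w else 0) = (\<Sum>p\<in>I. \<Sum>q\<in>I. \<Sum>r\<in>I. f p q r)" (is ?C)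
    and "(\<Sum>p\<in>I. \<Sum>q\<in>I. \<Sum>r\<in>I. \<Sum>w\<in>I. if q = w then f q p r else 0) = (\<Sum>p\<in>I. \<Sum>q\<in>I. \<Sum>r\<in>I. f p q r)" (is ?D)
proof -
  have inner: "(\<Sum>r\<in>I. \<Sum>w\<in>I. if p = r then g w else 0) = (\<Sum>w\<in>I. g w)" if "p \<in> I" for p and g :: "'i \<Rightarrow> real"
    by (subst sum.swap) (simp add: sum.delta' assms that)
  show ?A ?B by (simp_all add: inner sum.delta' assms cong: sum.cong)
  have "(\<Sum>p\<in>I. \<Sum>q\<in>I. \<Sum>r\<in>I. f q p r) = (\<Sum>p\<in>I. \<Sum>q\<in>I. \<Sum>r\<in>I. f p q r)" by (rule sum.swap)
  then show ?C ?D by (simp_all add: inner sum.delta' assms cong: sum.cong)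
qed

lemma sum4_delta2:
  fixes f :: "'i \<Rightarrow> 'i \<Rightarrow> real"
  assumes "finite I"
  shows "(\<Sum>p\<in>I. \<Sum>q\<in>I. \<Sum>r\<in>I. \<Sum>w\<in>I. if p = r \<and> q = w then f p q else 0) = (\<Sum>p\<in>I. \<Sum>q\<in>I. f p q)" (is ?A)
    and "(\<Sum>p\<in>I. \<Sum>q\<in>I. \<Sum>r\<in>I. \<Sum>w\<in>I. if p = w \<and> q = r then f p q else 0) = (\<Sum>p\<in>I. \<Sum>q\<in>I. f p q)" (is ?B)
    and "(\<Sum>p\<in>I. \<Sum>q\<in>I. \<Sum>r\<in>I. \<Sum>w\<in>I. if p = q \<and> p = r then f p w else 0) = (\<Sum>p\<in>I. \<Sum>q\<in>I. f p q)" (is ?C)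
    and "(\<Sum>p\<in>I. \<Sum>q\<in>I. \<Sum>r\<in>I. \<Sum>w\<in>I. if p = q \<and> p = w then f p r else 0) = (\<Sum>p\<in>I. \<Sum>q\<in>I. f p q)" (is ?D)
    and "(\<Sum>p\<in>I. \<Sum>q\<in>I. \<Sum>r\<in>I. \<Sum>w\<in>I. if p = r \<and> p = w then f p q else 0) = (\<Sum>p\<in>I. \<Sum>q\<in>I. f p q)" (is ?E)
    and "(\<Sum>p\<in>I. \<Sum>q\<in>I. \<Sum>r\<in>I. \<Sum>w\<in>I. if q = r \<and> q = w then f q p else 0) = (\<Sum>p\<in>I. \<Sum>q\<in>I. f p q)" (is ?F)
proof -
  note sum4_delta = sum4_delta[OF assms]
  have if_conj: "(if P \<and> Q then x else 0) = (if P then if Q then x else 0 else 0)" for P Q and x :: real by simp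
  have if_conj': "(if P \<and> Q then x else 0) = (if Q then if P then x else 0 else 0)" for P Q and x :: real by simp
  have rw: "(\<Sum>r\<in>I. if q = r then f p r else 0) = f p q" "(\<Sum>r\<in>I. if q = r then f p q else 0) = f p q"
    if "q \<in> I" for p q using that by (simp_all add: sum.delta' assms)
  show ?A ?B
    using sum4_delta(1)[of "\<lambda>p q w. if q = w then f p q else 0"]
      sum4_delta(2)[of "\<lambda>p q r. if q = r then f p q else 0"]
    by (simp_all add: if_conj rw cong: sum.cong)
  have "(\<Sum>q\<in>I. \<Sum>w\<in>I. if p = q then f p w else 0) = (\<Sum>q\<in>I. f p q)" if "p \<in> I" for p
    by (subst sum.swap) (simp add: sum.delta' assms that)
  then show ?C ?D
    using sum4_delta(1)[of "\<lambda>p q w. if p = q then f p w else 0"]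
      sum4_delta(2)[of "\<lambda>p q r. if p = q then f p r else 0"]
    by (simp_all add: if_conj' cong: sum.cong)
  show ?E ?F
    using sum4_delta(1)[of "\<lambda>p q w. if p = w then f p q else 0"]
      sum4_delta(3)[of "\<lambda>p q r. if p = r then f p q else 0"]
    by (simp_all add: if_conj sum.delta' assms cong: sum.cong)
qed

context substitution
begin

text \<open>Twice the bound for a quadruple with exactly two end points in cluster \<open>p\<close>,
  on different edges; the factor \<open>1/2\<close> is restored in \<open>card_mixed_le\<close>. The
  same holds for \<open>two_term\<close>.\<close>

definition pair_term :: "'i \<Rightarrow> 'i \<Rightarrow> 'i \<Rightarrow> real" where
  "pair_term p q r = (if p \<noteq> q \<and> p \<noteq> r \<and> q \<noteq> r \<and> sd p q * sd p r > 0
     then real (sz p) ^ 2 * real (sz q) * real (sz r) else 0)"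

definition two_term :: "'i \<Rightarrow> 'i \<Rightarrow> real" where
  "two_term p q = (if p \<noteq> q then real (sz p) ^ 2 * real (sz q) ^ 2 else 0)"

definition triple_term :: "'i \<Rightarrow> 'i \<Rightarrow> real" where
  "triple_term p q = (if p \<noteq> q
     then real (sz q) * real (if sd p q > 0 then card (upper_triples (S p)) else card (lower_triples (S p))) else 0)"

text \<open>The summands correspond to the coincidence patterns of the four clusters that admit
  crossings. For any given \<open>p\<close>, \<open>q\<close>, \<open>r\<close>, \<open>w\<close> at
  most one of them is nonzero, so the bound is the applicable case written as a sum, ready for
  summation.\<close>

lemma card_mixed_le:
  assumes I: "p \<in> I" "q \<in> I" "r \<in> I" "w \<in> I"
  shows "real (card (mixed p q r w)) \<le>
      real (sz p) * real (sz q) * real (sz r) * real (sz w) * of_bool (crossing (pt p) (pt q) (pt r) (pt w))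
    + 1/2 * (if p = r then pair_term p q w else 0) + 1/2 * (if p = w then pair_term p q r else 0)
    + 1/2 * (if q = r then pair_term q p w else 0) + 1/2 * (if q = w then pair_term q p r else 0)
    + 1/2 * (if p = r \<and> q = w then two_term p q else 0) + 1/2 * (if p = w \<and> q = r then two_term p q else 0)
    + (if p = q \<and> p = r then triple_term p w else 0) + (if p = q \<and> p = w then triple_term p r else 0)
    + (if p = r \<and> p = w then triple_term p q else 0) + (if q = r \<and> q = w then triple_term q p else 0)
    + (if p = q \<and> p = r \<and> p = w then real (card (crossings (S p))) else 0)" (is "_ \<le> ?rhs")
proof -
  have pair: "real (card (mixed p q p w)) \<le> 1/2 * pair_term p q w"
    if "p \<in> I" "q \<in> I" "w \<in> I" "p \<noteq> q" "p \<noteq> w" "q \<noteq> w" for p q w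
  proof -
    have "real (2 * card (mixed p q p w)) \<le> real (sz p ^ 2 * (sz q * sz w) * of_bool (sd p q * sd p w > 0))"
      using card_mixed_two_in_cluster[of p q w] that by (intro of_nat_mono) auto
    then show ?thesis using that by (cases "sd p q * sd p w > 0") (simp_all add: pair_term_def mult.assoc)
  qed
  have two: "real (card (mixed p q p q)) \<le> 1/2 * two_term p q" if "p \<in> I" "q \<in> I" "p \<noteq> q" for p q
  proof -
    have "real (2 * card (mixed p q p q)) \<le> real (sz p ^ 2 * sz q ^ 2)"
      using card_mixed_two_clusters[of p q] that by (intro of_nat_mono) auto
    then show ?thesis using that by (simp add: two_term_def)
  qed
  have triple: "real (card (mixed p p p w)) \<le> triple_term p w" if "p \<in> I" "w \<in> I" "p \<noteq> w" for p w
  proof -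
    have "real (card (mixed p p p w)) \<le>
        real (sz w * (if sd p w > 0 then card (upper_triples (S p)) else card (lower_triples (S p))))"
      using card_mixed_three_in_cluster[of p w] that by (intro of_nat_mono) auto
    then show ?thesis using that by (simp add: triple_term_def)
  qed
  consider (distinct) "distinct [p, q, r, w]" | (edge) "p = q" "r \<noteq> p" "w \<noteq> p" | (edge') "r = w" "p \<noteq> r" "q \<noteq> r"
    | (pr) "p = r" "p \<noteq> q" "p \<noteq> w" "q \<noteq> w" | (pw) "p = w" "p \<noteq> q" "p \<noteq> r" "q \<noteq> r"
    | (qr) "q = r" "p \<noteq> q" "p \<noteq> w" "q \<noteq> w" | (qw) "q = w" "p \<noteq> q" "p \<noteq> r" "q \<noteq> r"
    | (prqw) "p = r" "q = w" "p \<noteq> q" | (pwqr) "p = w" "q = r" "p \<noteq> q"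
    | (pqr) "p = q" "p = r" "p \<noteq> w" | (pqw) "p = q" "p = w" "p \<noteq> r"
    | (prw) "p = r" "p = w" "p \<noteq> q" | (qrw) "q = r" "q = w" "p \<noteq> q" | (one) "p = q" "p = r" "p = w"
    by auto
  then show ?thesis
  proof cases
    case distinct
    have "real (card (mixed p q r w)) \<le>
        real (sz p * sz q * sz r * sz w * of_bool (crossing (pt p) (pt q) (pt r) (pt w)))"
      using card_mixed_distinct[of p q r w] I distinct by (intro of_nat_mono) auto
    then show ?thesis using distinct by simp
  next
    case edge
    then have "mixed p q r w = {}" using mixed_edge_in_cluster[of p r w] I by auto
    then show ?thesis using edge by (simp add: two_term_def)
  next
    case edge'
    then have "card (mixed p q r w) = 0"
      using mixed_edge_in_cluster[of r p q] I card_mixed_sym(3)[of r w p q] by auto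
    then show ?thesis using edge' by simp
  next
    case pr
    then show ?thesis using pair[of p q w] I by (auto simp: crossing_def)
  next
    case pw
    then show ?thesis using pair[of p q r] I card_mixed_sym(2)[of p q r w]
      by (auto simp: crossing_def)
  next
    case qr
    then show ?thesis using pair[of q p w] I card_mixed_sym(1)[of q p r w]
      by (auto simp: crossing_def)
  next
    case qw
    then show ?thesis using pair[of q p r] I card_mixed_sym(1)[of q p r w] card_mixed_sym(2)[of q p w r]
      by (auto simp: crossing_def)
  next
    case prqw
    then show ?thesis using two[of p q] I by (auto simp: crossing_def pair_term_def)
  next
    case pwqr
    then show ?thesis using two[of p q] I card_mixed_sym(2)[of p q r w]
      by (auto simp: crossing_def pair_term_def)
  next
    case pqr
    then show ?thesis using triple[of p w] I by (auto simp: crossing_def pair_term_def two_term_def)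
  next
    case pqw
    then show ?thesis using triple[of p r] I card_mixed_sym(2)[of p q r w]
      by (auto simp: crossing_def pair_term_def two_term_def)
  next
    case prw
    then show ?thesis using triple[of p q] I card_mixed_sym(3)[of r w p q] card_mixed_sym(2)[of p p q p]
      by (auto simp: crossing_def pair_term_def two_term_def)
  next
    case qrw
    then show ?thesis using triple[of q p] I card_mixed_sym(3)[of r w p q] card_mixed_sym(2)[of q q p q]
      by (auto simp: crossing_def pair_term_def two_term_def)
  next
    case one
    have "real (card (mixed p p p p)) \<le> real (card (crossings (S p)))"
      using card_mixed_one_cluster[of p] I by (intro of_nat_mono) auto
    then show ?thesis using one by (simp add: pair_term_def two_term_def triple_term_def crossing_def)
  qed
qed

text \<open>The coefficients count placements: a shared pair has four with factor
  \<open>1/2\<close>, two shared pairs have two with factor \<open>1/2\<close>, and the end point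
  outside a shared triple has four.\<close>

lemma card_crossings_T_sum_le:
  "real (card (crossings T)) \<le>
      (\<Sum>p\<in>I. \<Sum>q\<in>I. \<Sum>r\<in>I. \<Sum>w\<in>I. real (sz p) * real (sz q) * real (sz r) * real (sz w)
        * of_bool (crossing (pt p) (pt q) (pt r) (pt w)))
    + 2 * (\<Sum>p\<in>I. \<Sum>q\<in>I. \<Sum>r\<in>I. pair_term p q r) + (\<Sum>p\<in>I. \<Sum>q\<in>I. two_term p q)
    + 4 * (\<Sum>p\<in>I. \<Sum>q\<in>I. triple_term p q) + (\<Sum>p\<in>I. real (card (crossings (S p))))"
proof -
  have one: "(\<Sum>p\<in>I. \<Sum>q\<in>I. \<Sum>r\<in>I. \<Sum>w\<in>I. if p = q \<and> p = r \<and> p = w then f p else 0) = (\<Sum>p\<in>I. f p)"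
    for f :: "'i \<Rightarrow> real"
  proof -
    have "(\<Sum>p\<in>I. \<Sum>q\<in>I. \<Sum>r\<in>I. \<Sum>w\<in>I. if p = q \<and> p = r \<and> p = w then f p else 0)
        = (\<Sum>p\<in>I. \<Sum>q\<in>I. \<Sum>r\<in>I. \<Sum>w\<in>I. if p = q \<and> p = r then if p = w then f p else 0 else 0)"
      by (intro sum.cong refl) auto
    also have "\<dots> = (\<Sum>p\<in>I. \<Sum>q\<in>I. if p = q then f p else 0)"
      by (rule sum4_delta2(3)[OF fin_I])
    finally show ?thesis by (simp add: sum.delta' fin_I)
  qed
  have "real (card (crossings T)) \<le> (\<Sum>p\<in>I. \<Sum>q\<in>I. \<Sum>r\<in>I. \<Sum>w\<in>I. real (card (mixed p q r w)))"
    using of_nat_mono[OF card_crossings_T_le, where 'a = real] by simp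
  also note sum_mono[OF sum_mono[OF sum_mono[OF sum_mono[OF card_mixed_le]]]]
  finally show ?thesis
    by (simp add: sum.distrib sum4_delta[OF fin_I] sum4_delta2[OF fin_I] one
        flip: sum_divide_distrib)
qed

end

section \<open>The bound from a weighted configuration\<close>

text \<open>Restricting the minimum to \<open>generic\<close> sets can only raise it, which is
  harmless for an upper bound.\<close>

definition min_crossings :: "nat \<Rightarrow> nat" where
  "min_crossings n = (LEAST k. \<exists>S. generic S \<and> card S = n \<and> card (crossings S) = k)"

lemma min_crossings_attained:
  obtains S where "generic S" "card S = n" "card (crossings S) = min_crossings n"
proof -
  have "\<exists>S. generic S \<and> card S = n \<and> card (crossings S) = min_crossings n"
    unfolding min_crossings_def by (rule LeastI_ex) (use exists_generic[of n] in blast)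
  with that show ?thesis by blast
qed

lemma min_crossings_le: "generic S \<Longrightarrow> min_crossings (card S) \<le> card (crossings S)"
  unfolding min_crossings_def by (rule Least_le) blast

lemma rect_cr_le_min_crossings: "8 * rect_cr n \<le> min_crossings n"
  by (metis min_crossings_attained rect_cr_le)

text \<open>Compare factor by factor: \<open>N * (j - i) \<le> j * (N - i)\<close> for
  \<open>i\<close> from 0 to 3.\<close>

lemma choose_4_ratio:
  assumes "4 \<le> j" "j \<le> N"
  shows "N ^ 4 * (j choose 4) \<le> j ^ 4 * (N choose 4)"
proof -
  have 1: "real N * (real j - i) \<le> real j * (real N - i)" if "0 \<le> i" for i
    using assms that mult_right_mono[of "real j" "real N" i] by (simp add: algebra_simps)
  have "real N ^ 4 * (real j * (real j - 1) * (real j - 2) * (real j - 3))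
      = (real N * (real j - 0)) * (real N * (real j - 1)) * (real N * (real j - 2)) * (real N * (real j - 3))"
    by (simp add: power4_eq_xxxx)
  also have "\<dots> \<le> (real j * (real N - 0)) * (real j * (real N - 1)) * (real j * (real N - 2)) * (real j * (real N - 3))"
    using assms by (intro mult_mono 1 mult_nonneg_nonneg) auto
  also have "\<dots> = real j ^ 4 * (real N * (real N - 1) * (real N - 2) * (real N - 3))"
    by (simp add: power4_eq_xxxx)
  finally have "real (N ^ 4 * (j choose 4)) \<le> real (j ^ 4 * (N choose 4))"
    by (simp add: choose_4_real)
  then show ?thesis by linarith
qed

lemma min_crossings_mono:
  assumes "4 \<le> j" "j \<le> N"
  shows "min_crossings j * N ^ 4 \<le> min_crossings N * j ^ 4"
proof -
  obtain T where T: "generic T" "card T = N" "card (crossings T) = min_crossings N"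
    by (rule min_crossings_attained)
  have "min_crossings j * (card T choose 4) \<le> card (crossings T) * (j choose 4)"
    using assms T generic_subset[OF T(1)] min_crossings_le
    by (intro crossings_averaging) (auto simp: generic_def)
  then have le: "min_crossings j * (N choose 4) \<le> min_crossings N * (j choose 4)"
    unfolding T .
  have "(min_crossings j * N ^ 4) * (j choose 4) = min_crossings j * (N ^ 4 * (j choose 4))"
    by (simp only: mult.assoc)
  also have "\<dots> \<le> min_crossings j * (j ^ 4 * (N choose 4))"
    by (rule mult_left_mono[OF choose_4_ratio[OF assms]]) simp
  also have "\<dots> = j ^ 4 * (min_crossings j * (N choose 4))"
    by (simp only: ac_simps)
  also have "\<dots> \<le> j ^ 4 * (min_crossings N * (j choose 4))"
    by (rule mult_left_mono[OF le]) simp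
  also have "\<dots> = (min_crossings N * j ^ 4) * (j choose 4)"
    by (simp only: ac_simps)
  finally show ?thesis using assms by simp
qed

lemma side_uminus: "side (- v) p q = - side v p q"
  by (simp add: side_def)

context configuration
begin

definition other_sum :: "('i \<Rightarrow> real) \<Rightarrow> 'i \<Rightarrow> real" where
  "other_sum f p = (\<Sum>q\<in>I. if q \<noteq> p then f q else 0)"

definition left_sum :: "('i \<Rightarrow> real) \<Rightarrow> 'i \<Rightarrow> real" where
  "left_sum f p = (\<Sum>q\<in>I. if q \<noteq> p \<and> side (v p) (pt p) (pt q) > 0 then f q else 0)"

definition right_sum :: "('i \<Rightarrow> real) \<Rightarrow> 'i \<Rightarrow> real" where
  "right_sum f p = (\<Sum>q\<in>I. if q \<noteq> p \<and> side (v p) (pt p) (pt q) < 0 then f q else 0)"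

definition crossing_sum :: "('i \<Rightarrow> real) \<Rightarrow> real" where
  "crossing_sum f = (\<Sum>p\<in>I. \<Sum>q\<in>I. \<Sum>r\<in>I. \<Sum>w\<in>I. f p * f q * f r * f w
     * of_bool (crossing (pt p) (pt q) (pt r) (pt w)))"

text \<open>The constant \<open>2 / 3\<close> is \<open>4 * 1/2 * 1/3\<close>: four placements of
  the outer point, the average over the two directions of the line, and the share of triples with a
  prescribed middle element.\<close>

definition degenerate_sum :: "('i \<Rightarrow> real) \<Rightarrow> real" where
  "degenerate_sum f = (\<Sum>p\<in>I. 2 * f p ^ 2 * (left_sum f p ^ 2 + right_sum f p ^ 2 - other_sum (\<lambda>q. f q ^ 2) p)
     + f p ^ 2 * other_sum (\<lambda>q. f q ^ 2) p + 2 / 3 * f p ^ 3 * other_sum f p)"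

lemma left_sum_plus_right_sum: "p \<in> I \<Longrightarrow> left_sum f p + right_sum f p = other_sum f p"
  unfolding left_sum_def right_sum_def other_sum_def sum.distrib[symmetric]
  using side_pt by (intro sum.cong) (auto simp: not_less_iff_gr_or_eq)

lemma same_side_pairs:
  assumes "p \<in> I"
  shows "(\<Sum>q\<in>I. \<Sum>r\<in>I. if p \<noteq> q \<and> p \<noteq> r \<and> q \<noteq> r \<and> side (v p) (pt p) (pt q) * side (v p) (pt p) (pt r) > 0
      then f q * f r else 0) = left_sum f p ^ 2 + right_sum f p ^ 2 - other_sum (\<lambda>q. f q ^ 2) p"
proof -
  let ?sd = "\<lambda>q. side (v p) (pt p) (pt q)"
  let ?l = "\<lambda>q. if q \<noteq> p \<and> ?sd q > 0 then f q else 0"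
  let ?r = "\<lambda>q. if q \<noteq> p \<and> ?sd q < 0 then f q else 0"
  let ?o = "\<lambda>q. if q \<noteq> p then f q ^ 2 else 0"
  have "(if p \<noteq> q \<and> p \<noteq> r \<and> q \<noteq> r \<and> ?sd q * ?sd r > 0 then f q * f r else 0)
      = ?l q * ?l r + ?r q * ?r r - (if q = r then ?o q else 0)" if "q \<in> I" "r \<in> I" for q r
    using side_pt[OF assms that(1)] side_pt[OF assms that(2)]
    by (auto simp: zero_less_mult_iff power2_eq_square not_less_iff_gr_or_eq)
  then have "(\<Sum>q\<in>I. \<Sum>r\<in>I. if p \<noteq> q \<and> p \<noteq> r \<and> q \<noteq> r \<and> ?sd q * ?sd r > 0 then f q * f r else 0)
      = (\<Sum>q\<in>I. \<Sum>r\<in>I. ?l q * ?l r + ?r q * ?r r - (if q = r then ?o q else 0))"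
    by (intro sum.cong refl)
  also have "\<dots> = (\<Sum>q\<in>I. ?l q) * (\<Sum>q\<in>I. ?l q) + (\<Sum>q\<in>I. ?r q) * (\<Sum>q\<in>I. ?r q) - (\<Sum>q\<in>I. ?o q)"
    by (simp add: sum.distrib sum_subtractf sum_product sum.delta' fin_I)
  finally show ?thesis
    unfolding left_sum_def right_sum_def other_sum_def power2_eq_square[of "sum _ _"] .
qed

theorem min_crossings_weighted:
  fixes wt :: "'i \<Rightarrow> nat"
  defines "w \<equiv> \<lambda>p. real (wt p)" and "W \<equiv> \<Sum>p\<in>I. real (wt p)"
  assumes wt: "\<And>p. p \<in> I \<Longrightarrow> wt p > 0" and ne: "I \<noteq> {}" and le: "(\<Sum>p\<in>I. w p ^ 4) \<le> W ^ 4" and n: "4 \<le> n"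
  shows "(W ^ 4 - (\<Sum>p\<in>I. w p ^ 4)) * real (min_crossings n) \<le> (crossing_sum w + degenerate_sum w) * real n ^ 4"
proof -
  have "\<exists>S. generic S \<and> card S = wt p * n \<and> card (crossings S) = min_crossings (wt p * n)" for p
    using min_crossings_attained by metis
  then obtain S where S: "\<And>p. generic (S p)" "\<And>p. card (S p) = wt p * n"
    "\<And>p. card (crossings (S p)) = min_crossings (wt p * n)" by metis
  define u where "u p = real (card (upper_triples (S p)))" for p
  define l where "l p = real (card (lower_triples (S p)))" for p
  \<comment> \<open>Reversing the direction at \<open>p\<close> swaps the roles of the two sides; the better choice is at most the average.\<close>
  define flipped where "flipped p \<longleftrightarrow>
    right_sum w p * u p + left_sum w p * l p < left_sum w p * u p + right_sum w p * l p" for p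
  define v' where "v' p = (if flipped p then - v p else v p)" for p
  have side': "side (v' p) (pt p) (pt q) = (if flipped p then - 1 else 1) * side (v p) (pt p) (pt q)" for p q
    by (simp add: v'_def side_uminus)
  have conf: "configuration I pt v'"
    using fin_I fst_pt orient_pt fst_v side_pt by unfold_locales (auto simp: v'_def side_uminus)
  obtain \<delta> where "substitution I pt v' S \<delta>"
    using configuration.exists_substitution[OF conf, of S] S(1) by blast
  then interpret sub: substitution I pt v' S \<delta> .
  define N where "N = card sub.T"
  define Y where "Y = real (min_crossings N)"
  have NW: "real N = W * real n"
    by (simp add: N_def sub.card_T S(2) W_def sum_distrib_right)
  have "Y \<le> real (card (crossings sub.T))"
    using min_crossings_le[OF sub.generic_T] by (simp add: Y_def N_def)
  note this also note sub.card_crossings_T_sum_le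
  also have "(\<Sum>p\<in>I. \<Sum>q\<in>I. \<Sum>r\<in>I. \<Sum>x\<in>I. real (card (S p)) * real (card (S q)) * real (card (S r)) * real (card (S x))
        * of_bool (crossing (pt p) (pt q) (pt r) (pt x))) = crossing_sum w * real n ^ 4"
    unfolding crossing_sum_def sum_distrib_right S(2) w_def
    by (intro sum.cong refl) (simp add: power4_eq_xxxx ac_simps)
  also have "(\<Sum>p\<in>I. \<Sum>q\<in>I. \<Sum>r\<in>I. sub.pair_term p q r)
      = (\<Sum>p\<in>I. w p ^ 2 * (left_sum w p ^ 2 + right_sum w p ^ 2 - other_sum (\<lambda>q. w q ^ 2) p)) * real n ^ 4"
    unfolding sum_distrib_right
  proof (intro sum.cong refl)
    fix p assume p: "p \<in> I"
    \<comment> \<open>Reversing the direction changes both signs in the product of sides, so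
      \<open>flipped\<close> does not affect these terms.\<close>
    have "sub.pair_term p q r = (if p \<noteq> q \<and> p \<noteq> r \<and> q \<noteq> r \<and> side (v p) (pt p) (pt q) * side (v p) (pt p) (pt r) > 0
        then w q * w r else 0) * (w p ^ 2 * real n ^ 4)" for q r
      by (simp add: sub.pair_term_def side' S(2) w_def power2_eq_square power4_eq_xxxx ac_simps)
    then have "(\<Sum>q\<in>I. \<Sum>r\<in>I. sub.pair_term p q r)
        = (left_sum w p ^ 2 + right_sum w p ^ 2 - other_sum (\<lambda>q. w q ^ 2) p) * (w p ^ 2 * real n ^ 4)"
      using same_side_pairs[OF p, of w] by (simp flip: sum_distrib_right)
    then show "(\<Sum>q\<in>I. \<Sum>r\<in>I. sub.pair_term p q r)
        = w p ^ 2 * (left_sum w p ^ 2 + right_sum w p ^ 2 - other_sum (\<lambda>q. w q ^ 2) p) * real n ^ 4"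
      by (simp add: ac_simps)
  qed
  also have "(\<Sum>p\<in>I. \<Sum>q\<in>I. sub.two_term p q) = (\<Sum>p\<in>I. w p ^ 2 * other_sum (\<lambda>q. w q ^ 2) p) * real n ^ 4"
    unfolding sum_distrib_right other_sum_def sum_distrib_left
    by (intro sum.cong refl) (auto simp: sub.two_term_def S(2) w_def power2_eq_square power4_eq_xxxx)
  finally have Y1: "Y \<le> (crossing_sum w
      + 2 * (\<Sum>p\<in>I. w p ^ 2 * (left_sum w p ^ 2 + right_sum w p ^ 2 - other_sum (\<lambda>q. w q ^ 2) p))
      + (\<Sum>p\<in>I. w p ^ 2 * other_sum (\<lambda>q. w q ^ 2) p)) * real n ^ 4
    + 4 * (\<Sum>p\<in>I. \<Sum>q\<in>I. sub.triple_term p q) + (\<Sum>p\<in>I. real (min_crossings (wt p * n)))"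
    by (simp add: algebra_simps S(3))
  have triple: "(\<Sum>q\<in>I. sub.triple_term p q) \<le> w p ^ 3 * other_sum w p / 6 * real n ^ 4" if p: "p \<in> I" for p
  proof -
    have "sub.triple_term p q = (if q \<noteq> p \<and> side (v p) (pt p) (pt q) > 0 then w q else 0) * ((if flipped p then l p else u p) * real n)
        + (if q \<noteq> p \<and> side (v p) (pt p) (pt q) < 0 then w q else 0) * ((if flipped p then u p else l p) * real n)"
      if "q \<in> I" for q
      using side_pt[OF p that] by (auto simp: sub.triple_term_def side' S(2) w_def u_def l_def)
    then have "(\<Sum>q\<in>I. sub.triple_term p q) = left_sum w p * ((if flipped p then l p else u p) * real n)
        + right_sum w p * ((if flipped p then u p else l p) * real n)"
      unfolding left_sum_def right_sum_def sum_distrib_right sum.distrib[symmetric] by (intro sum.cong refl)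
    also have "\<dots> = (if flipped p then right_sum w p * u p + left_sum w p * l p
        else left_sum w p * u p + right_sum w p * l p) * real n"
      by (simp add: algebra_simps)
    \<comment> \<open>The values for the two directions add up to
      \<open>(left_sum w p + right_sum w p) * (u p + l p)\<close>, and \<open>flipped\<close>
      selects the smaller one.\<close>
    also have "\<dots> \<le> (left_sum w p + right_sum w p) * (u p + l p) / 2 * real n"
      by (intro mult_right_mono) (auto simp: flipped_def algebra_simps)
    also have "\<dots> = other_sum w p / 2 * real n * (u p + l p)"
      by (simp add: left_sum_plus_right_sum[OF p] ac_simps)
    also have "\<dots> \<le> other_sum w p / 2 * real n * ((w p * real n) ^ 3 / 3)"
    proof (intro mult_left_mono mult_nonneg_nonneg)
      have "real (3 * (card (upper_triples (S p)) + card (lower_triples (S p)))) \<le> real (card (S p) ^ 3)"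
        using card_upper_lower_triples[OF sub.fin_S[OF p]] by (rule of_nat_mono)
      then show "u p + l p \<le> (w p * real n) ^ 3 / 3" by (simp add: u_def l_def S(2) w_def)
    qed (auto simp: other_sum_def w_def intro!: sum_nonneg)
    finally show ?thesis by (simp add: power_mult_distrib power3_eq_cube power4_eq_xxxx ac_simps)
  qed
  have Wpos: "W > 0"
    unfolding W_def using ne wt fin_I by (intro sum_pos) auto
  have wt_le: "wt p * n \<le> N" if "p \<in> I" for p
    unfolding N_def sub.card_T S(2) using fin_I that by (intro member_le_sum) auto
  \<comment> \<open>Monotonicity between \<open>wt p * n\<close> and \<open>N = W * n\<close>. It
    bounds the inner crossings by a multiple of \<open>Y\<close> itself, which can then be moved to
    the left.\<close>
  have one: "real (min_crossings (wt p * n)) \<le> Y * w p ^ 4 / W ^ 4" if p: "p \<in> I" for p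
  proof -
    have "4 \<le> wt p * n" using n wt[OF p] mult_le_mono[of 1 "wt p" 4 n] by simp
    then have "real (min_crossings (wt p * n) * N ^ 4) \<le> real (min_crossings N * (wt p * n) ^ 4)"
      using min_crossings_mono[of "wt p * n" N] wt_le[OF p] by (intro of_nat_mono) auto
    then have "real (min_crossings (wt p * n)) * W ^ 4 * real n ^ 4 \<le> Y * w p ^ 4 * real n ^ 4"
      by (simp add: NW power_mult_distrib Y_def w_def ac_simps)
    then show ?thesis using n Wpos by (simp add: field_simps)
  qed
  have "Y \<le> (crossing_sum w
      + 2 * (\<Sum>p\<in>I. w p ^ 2 * (left_sum w p ^ 2 + right_sum w p ^ 2 - other_sum (\<lambda>q. w q ^ 2) p))
      + (\<Sum>p\<in>I. w p ^ 2 * other_sum (\<lambda>q. w q ^ 2) p)) * real n ^ 4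
    + 4 * (\<Sum>p\<in>I. w p ^ 3 * other_sum w p / 6 * real n ^ 4) + (\<Sum>p\<in>I. Y * w p ^ 4 / W ^ 4)"
  proof -
    have "(\<Sum>p\<in>I. \<Sum>q\<in>I. sub.triple_term p q) \<le> (\<Sum>p\<in>I. w p ^ 3 * other_sum w p / 6 * real n ^ 4)"
      by (rule sum_mono) (rule triple)
    moreover have "(\<Sum>p\<in>I. real (min_crossings (wt p * n))) \<le> (\<Sum>p\<in>I. Y * w p ^ 4 / W ^ 4)"
      by (rule sum_mono) (rule one)
    ultimately show ?thesis using Y1 by linarith
  qed
  also have "\<dots> = (crossing_sum w + degenerate_sum w) * real n ^ 4 + Y * (\<Sum>p\<in>I. w p ^ 4) / W ^ 4"
  proof -
    have "4 * (\<Sum>p\<in>I. w p ^ 3 * other_sum w p / 6 * real n ^ 4) = (\<Sum>p\<in>I. 2 / 3 * w p ^ 3 * other_sum w p) * real n ^ 4"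
      unfolding sum_distrib_left sum_distrib_right by (intro sum.cong refl) simp
    moreover have "(\<Sum>p\<in>I. Y * w p ^ 4 / W ^ 4) = Y * (\<Sum>p\<in>I. w p ^ 4) / W ^ 4"
      by (simp add: sum_distrib_left sum_divide_distrib)
    moreover have "degenerate_sum w
        = 2 * (\<Sum>p\<in>I. w p ^ 2 * (left_sum w p ^ 2 + right_sum w p ^ 2 - other_sum (\<lambda>q. w q ^ 2) p))
        + (\<Sum>p\<in>I. w p ^ 2 * other_sum (\<lambda>q. w q ^ 2) p) + (\<Sum>p\<in>I. 2 / 3 * w p ^ 3 * other_sum w p)"
      unfolding degenerate_sum_def sum_distrib_left sum.distrib[symmetric] by (intro sum.cong refl) simp
    ultimately show ?thesis by (simp add: algebra_simps)
  qed
  finally have "Y * (W ^ 4 - (\<Sum>p\<in>I. w p ^ 4)) \<le> (crossing_sum w + degenerate_sum w) * real n ^ 4 * W ^ 4"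
    using Wpos by (simp add: field_simps)
  \<comment> \<open>Monotonicity once more, between \<open>n\<close> and \<open>N\<close>, returns
    from \<open>Y\<close> to \<open>n\<close> points.\<close>
  moreover have "real (min_crossings n) * W ^ 4 \<le> Y"
  proof -
    obtain p where p: "p \<in> I" using ne by blast
    have "n \<le> N" using wt_le[OF p] wt[OF p] by (metis One_nat_def Suc_leI le_trans mult.commute mult.right_neutral mult_le_mono2)
    then have "real (min_crossings n * N ^ 4) \<le> real (min_crossings N * n ^ 4)"
      using min_crossings_mono[of n N] n by (intro of_nat_mono) auto
    then show ?thesis using n by (simp add: NW power_mult_distrib Y_def)
  qed
  then have "real (min_crossings n) * W ^ 4 * (W ^ 4 - (\<Sum>p\<in>I. w p ^ 4)) \<le> Y * (W ^ 4 - (\<Sum>p\<in>I. w p ^ 4))"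
    using le by (intro mult_right_mono) auto
  ultimately have "((W ^ 4 - (\<Sum>p\<in>I. w p ^ 4)) * real (min_crossings n)) * W ^ 4
      \<le> ((crossing_sum w + degenerate_sum w) * real n ^ 4) * W ^ 4"
    by (simp add: ac_simps)
  then show ?thesis using Wpos by simp
qed

end

section \<open>Crossings and imbalances\<close>

lemma sum4_transpose:
  fixes f :: "'i \<Rightarrow> 'i \<Rightarrow> 'i \<Rightarrow> 'i \<Rightarrow> real"
  shows "(\<Sum>p\<in>I. \<Sum>q\<in>I. \<Sum>r\<in>I. \<Sum>x\<in>I. f q p r x) = (\<Sum>p\<in>I. \<Sum>q\<in>I. \<Sum>r\<in>I. \<Sum>x\<in>I. f p q r x)"
    and "(\<Sum>p\<in>I. \<Sum>q\<in>I. \<Sum>r\<in>I. \<Sum>x\<in>I. f p r q x) = (\<Sum>p\<in>I. \<Sum>q\<in>I. \<Sum>r\<in>I. \<Sum>x\<in>I. f p q r x)"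
    and "(\<Sum>p\<in>I. \<Sum>q\<in>I. \<Sum>r\<in>I. \<Sum>x\<in>I. f p q x r) = (\<Sum>p\<in>I. \<Sum>q\<in>I. \<Sum>r\<in>I. \<Sum>x\<in>I. f p q r x)"
  by (rule sum.swap) (intro sum.cong refl sum.swap)+

text \<open>Each product belongs to a line through two of four points and is -1 if it separates the
  other two. In convex position the four sides give +1 and the two diagonals -1, in total 2;
  otherwise three hull edges give +1 and three inner edges -1, in total 0. The relation
  \<open>d = a - b + c\<close> between the orientations excludes the remaining sign
  patterns.\<close>

lemma sgn_products_four_points:
  fixes a b c d :: real
  assumes "a \<noteq> 0" "b \<noteq> 0" "c \<noteq> 0" "d \<noteq> 0" "d = a - b + c"
  shows "sgn a * sgn b - sgn a * sgn c + sgn b * sgn c + sgn a * sgn d - sgn b * sgn d + sgn c * sgn d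
    = 2 * (of_bool (a * b < 0 \<and> c * d < 0) + of_bool (a * c > 0 \<and> b * d > 0) + of_bool (b * c < 0 \<and> a * d < 0))"
  using assms by (auto simp: sgn_if mult_less_0_iff zero_less_mult_iff of_bool_def)

context configuration
begin

lemma sgn_products_crossing:
  defines "\<sigma> \<equiv> \<lambda>p q r x. (if r = x then 0 else sgn (orient (pt p) (pt q) (pt r)) * sgn (orient (pt p) (pt q) (pt x)))"
  assumes I: "p \<in> I" "q \<in> I" "r \<in> I" "x \<in> I"
  shows "\<sigma> p q r x + \<sigma> p r q x + \<sigma> p x q r + \<sigma> q r p x + \<sigma> q x p r + \<sigma> r x p q
    = 2 * (of_bool (crossing (pt p) (pt q) (pt r) (pt x)) + of_bool (crossing (pt p) (pt r) (pt q) (pt x))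
        + of_bool (crossing (pt p) (pt x) (pt q) (pt r)))"
proof (cases "distinct [p, q, r, x]")
  case True
  define a b c d where abcd: "a = orient (pt p) (pt q) (pt r)" "b = orient (pt p) (pt q) (pt x)"
    "c = orient (pt p) (pt r) (pt x)" "d = orient (pt q) (pt r) (pt x)"
  have nz: "a \<noteq> 0" "b \<noteq> 0" "c \<noteq> 0" "d \<noteq> 0" using True I orient_pt by (auto simp: abcd)
  have d: "d = a - b + c" by (simp add: abcd orient_def algebra_simps)
  have o: "orient (pt p) (pt q) (pt r) = a" "orient (pt p) (pt q) (pt x) = b" "orient (pt p) (pt r) (pt q) = - a"
    "orient (pt p) (pt r) (pt x) = c" "orient (pt p) (pt x) (pt q) = - b" "orient (pt p) (pt x) (pt r) = - c"
    "orient (pt q) (pt r) (pt p) = a" "orient (pt q) (pt r) (pt x) = d" "orient (pt q) (pt x) (pt p) = b"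
    "orient (pt q) (pt x) (pt r) = - d" "orient (pt r) (pt x) (pt p) = c" "orient (pt r) (pt x) (pt q) = d"
    by (simp_all add: abcd orient_def algebra_simps)
  show ?thesis
    unfolding \<sigma>_def crossing_def o using True sgn_products_four_points[OF nz d]
    by (simp add: sgn_minus algebra_simps)
next
  case False
  then show ?thesis by (auto simp: \<sigma>_def crossing_def)
qed

text \<open>Counting, for every four points, the lines through two of them which separate the other two,
  expresses the number of crossings by the imbalances of these lines.\<close>

lemma crossing_sum_eq:
  "crossing_sum f = (\<Sum>p\<in>I. \<Sum>q\<in>I. f p * f q * ((\<Sum>r\<in>I. f r * sgn (orient (pt p) (pt q) (pt r)))\<^sup>2
     - (\<Sum>r\<in>I. (f r)\<^sup>2 * (sgn (orient (pt p) (pt q) (pt r)))\<^sup>2)))"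
proof -
  define \<sigma> where "\<sigma> p q r x = (if r = x then 0 else sgn (orient (pt p) (pt q) (pt r)) * sgn (orient (pt p) (pt q) (pt x)))" for p q r x
  define F where "F p q r x = f p * f q * f r * f x" for p q r x
  define C where "C p q r x = F p q r x * of_bool (crossing (pt p) (pt q) (pt r) (pt x))" for p q r x
  define D where "D p q r x = F p q r x * \<sigma> p q r x" for p q r x
  let ?S = "\<lambda>g. \<Sum>p\<in>I. \<Sum>q\<in>I. \<Sum>r\<in>I. \<Sum>x\<in>I. g p q r x"
  note tr = sum4_transpose
  have "?S D = (\<Sum>p\<in>I. \<Sum>q\<in>I. f p * f q * ((\<Sum>r\<in>I. f r * sgn (orient (pt p) (pt q) (pt r)))\<^sup>2
     - (\<Sum>r\<in>I. (f r)\<^sup>2 * (sgn (orient (pt p) (pt q) (pt r)))\<^sup>2)))"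
  proof (intro sum.cong refl)
    fix p q
    let ?g = "\<lambda>r. f r * sgn (orient (pt p) (pt q) (pt r))"
    have "(\<Sum>r\<in>I. \<Sum>x\<in>I. D p q r x) = (\<Sum>r\<in>I. \<Sum>x\<in>I. f p * f q * (?g r * ?g x - (if r = x then (?g r)\<^sup>2 else 0)))"
      by (intro sum.cong refl) (auto simp: D_def F_def \<sigma>_def power2_eq_square)
    also have "\<dots> = f p * f q * ((\<Sum>r\<in>I. ?g r) * (\<Sum>r\<in>I. ?g r) - (\<Sum>r\<in>I. (?g r)\<^sup>2))"
      by (simp add: sum_subtractf sum_product fin_I sum.delta' flip: sum_distrib_left)
    finally show "(\<Sum>r\<in>I. \<Sum>x\<in>I. D p q r x) = f p * f q * ((\<Sum>r\<in>I. ?g r)\<^sup>2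
     - (\<Sum>r\<in>I. (f r)\<^sup>2 * (sgn (orient (pt p) (pt q) (pt r)))\<^sup>2))"
      by (simp add: power2_eq_square[of "sum _ _"] power_mult_distrib)
  qed
  \<comment> \<open>Summed over all quadruples, the six relabelled copies of \<open>D\<close> agree,
    and so do the three relabelled copies of \<open>C\<close>, which occur with factor 2.\<close>
  moreover have "6 * ?S D = 6 * ?S C"
  proof -
    have "?S D + ?S (\<lambda>p q r x. D p r q x) + ?S (\<lambda>p q r x. D p x q r) + ?S (\<lambda>p q r x. D q r p x)
        + ?S (\<lambda>p q r x. D q x p r) + ?S (\<lambda>p q r x. D r x p q)
        = ?S (\<lambda>p q r x. D p q r x + D p r q x + D p x q r + D q r p x + D q x p r + D r x p q)"
      by (simp add: sum.distrib)
    also have "\<dots> = ?S (\<lambda>p q r x. 2 * (C p q r x + C p r q x + C p x q r))"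
    proof (intro sum.cong refl)
      fix p q r x assume "p \<in> I" "q \<in> I" "r \<in> I" "x \<in> I"
      note sgn_products_crossing[OF this, folded \<sigma>_def]
      from arg_cong[OF this, of "\<lambda>y. F p q r x * y"]
      show "D p q r x + D p r q x + D p x q r + D q r p x + D q x p r + D r x p q = 2 * (C p q r x + C p r q x + C p x q r)"
        by (simp add: D_def C_def F_def algebra_simps)
    qed
    also have "\<dots> = 2 * (?S C + ?S (\<lambda>p q r x. C p r q x) + ?S (\<lambda>p q r x. C p x q r))"
      by (simp add: sum.distrib flip: sum_distrib_left)
    finally have sum_eq: "?S D + ?S (\<lambda>p q r x. D p r q x) + ?S (\<lambda>p q r x. D p x q r) + ?S (\<lambda>p q r x. D q r p x)
        + ?S (\<lambda>p q r x. D q x p r) + ?S (\<lambda>p q r x. D r x p q)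
        = 2 * (?S C + ?S (\<lambda>p q r x. C p r q x) + ?S (\<lambda>p q r x. C p x q r))" .
    have prqx: "?S (\<lambda>p q r x. g p r q x) = ?S g" for g :: "'i \<Rightarrow> 'i \<Rightarrow> 'i \<Rightarrow> 'i \<Rightarrow> real" by (rule tr(2))
    have pxqr: "?S (\<lambda>p q r x. g p x q r) = ?S g" for g :: "'i \<Rightarrow> 'i \<Rightarrow> 'i \<Rightarrow> 'i \<Rightarrow> real"
      by (rule trans[OF tr(3)[of "\<lambda>p q r x. g p r q x"] tr(2)])
    have qrpx: "?S (\<lambda>p q r x. g q r p x) = ?S g" for g :: "'i \<Rightarrow> 'i \<Rightarrow> 'i \<Rightarrow> 'i \<Rightarrow> real"
      by (rule trans[OF tr(1)[of "\<lambda>p q r x. g p r q x"] tr(2)])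
    have qxpr: "?S (\<lambda>p q r x. g q x p r) = ?S g" for g :: "'i \<Rightarrow> 'i \<Rightarrow> 'i \<Rightarrow> 'i \<Rightarrow> real"
      by (rule trans[OF tr(1)[of "\<lambda>p q r x. g p x q r"] pxqr])
    have rxpq: "?S (\<lambda>p q r x. g r x p q) = ?S g" for g :: "'i \<Rightarrow> 'i \<Rightarrow> 'i \<Rightarrow> 'i \<Rightarrow> real"
      by (rule trans[OF tr(2)[of "\<lambda>p q r x. g q x p r"] qxpr])
    show ?thesis
      using sum_eq unfolding prqx[of D] pxqr[of D] qrpx[of D] qxpr[of D] rxpq[of D] prqx[of C] pxqr[of C]
      by simp
  qed
  ultimately show ?thesis by (simp add: crossing_sum_def C_def F_def)
qed

end

text \<open>If \<open>d\<close> is the weight ahead minus the weight passed while sweeping through the list, then \<open>d - z\<close> is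
  the imbalance seen from the current element.\<close>

fun scan :: "'a::linordered_idom \<Rightarrow> 'a list \<Rightarrow> 'a" where
  "scan d [] = 0"
| "scan d (z # zs) = \<bar>z\<bar> * ((d - z) * (d - z)) + scan (d - 2 * z) zs"

lemma of_int_scan: "of_int (scan d zs) = (scan (of_int d) (map of_int zs) :: real)"
  by (induction zs arbitrary: d) simp_all

text \<open>\<open>pre\<close> is the part already swept, which the induction needs. Weights may be
  negative because they carry the sign of a reflection; hence the absolute value as
  multiplier.\<close>

lemma scan_sorted_wrt:
  fixes z k :: "'u \<Rightarrow> real"
  assumes "sorted_wrt (\<lambda>u u'. k u < k u') (pre @ us)"
  shows "(\<Sum>u\<leftarrow>us. \<bar>z u\<bar> * (\<Sum>r\<leftarrow>pre @ us. z r * sgn (k r - k u))\<^sup>2)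
    = scan (sum_list (map z us) - sum_list (map z pre)) (map z us)"
  using assms
proof (induction us arbitrary: pre)
  case (Cons u us)
  have neg: "(\<Sum>r\<leftarrow>xs. - z r) = - sum_list (map z xs)" for xs by (induction xs) simp_all
  have "(\<Sum>r\<leftarrow>pre. z r * sgn (k r - k u)) = (\<Sum>r\<leftarrow>pre. - z r)"
    using Cons.prems by (intro arg_cong[of _ _ sum_list] map_cong) (auto simp: sorted_wrt_append sgn_if)
  moreover have "(\<Sum>r\<leftarrow>us. z r * sgn (k r - k u)) = (\<Sum>r\<leftarrow>us. z r)"
    using Cons.prems by (intro arg_cong[of _ _ sum_list] map_cong) (auto simp: sorted_wrt_append sgn_if)
  ultimately have hd: "(\<Sum>r\<leftarrow>pre @ u # us. z r * sgn (k r - k u)) = sum_list (map z us) - sum_list (map z pre)"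
    by (simp add: neg)
  have tl: "(\<Sum>u'\<leftarrow>us. \<bar>z u'\<bar> * (\<Sum>r\<leftarrow>pre @ u # us. z r * sgn (k r - k u'))\<^sup>2)
      = scan (sum_list (map z us) - (sum_list (map z pre) + z u)) (map z us)"
    using Cons.IH[of "pre @ [u]"] Cons.prems by simp
  have d: "sum_list (map z (u # us)) - sum_list (map z pre) - z u = sum_list (map z us) - sum_list (map z pre)"
    "sum_list (map z (u # us)) - sum_list (map z pre) - 2 * z u = sum_list (map z us) - (sum_list (map z pre) + z u)"
    by simp_all
  have "(\<Sum>u'\<leftarrow>u # us. \<bar>z u'\<bar> * (\<Sum>r\<leftarrow>pre @ u # us. z r * sgn (k r - k u'))\<^sup>2)
      = \<bar>z u\<bar> * (\<Sum>r\<leftarrow>pre @ u # us. z r * sgn (k r - k u))\<^sup>2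
        + (\<Sum>u'\<leftarrow>us. \<bar>z u'\<bar> * (\<Sum>r\<leftarrow>pre @ u # us. z r * sgn (k r - k u'))\<^sup>2)"
    by simp
  also have "\<dots> = scan (sum_list (map z (u # us)) - sum_list (map z pre)) (map z (u # us))"
    unfolding hd tl list.map(2)[of z u us] scan.simps d power2_eq_square[of "_ - _"]
    by (simp add: diff_diff_eq)
  finally show ?case .
qed simp

section \<open>A configuration of 57 weighted points\<close>

text \<open>A row \<open>(x, y, w, a, b, l, i)\<close> is a point \<open>(x, y)\<close> of weight \<open>w\<close>, found by simulated annealing,
  together with the direction \<open>(a, b)\<close> along which its cluster is flattened. The last two entries are certificates:
  \<open>l\<close> is the total weight to the left of that direction, and \<open>i\<close> is the sum over the other points \<open>q\<close> of
  the weight of \<open>q\<close> times the squared difference of the weights on both sides of the line through \<open>(x, y)\<close> and \<open>q\<close>.\<close>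

type_synonym row = "int \<times> int \<times> int \<times> int \<times> int \<times> int \<times> int"

fun xc :: "row \<Rightarrow> int" where "xc (x, y, w, a, b, l, i) = x"
fun yc :: "row \<Rightarrow> int" where "yc (x, y, w, a, b, l, i) = y"
fun wc :: "row \<Rightarrow> int" where "wc (x, y, w, a, b, l, i) = w"
fun ac :: "row \<Rightarrow> int" where "ac (x, y, w, a, b, l, i) = a"
fun bc :: "row \<Rightarrow> int" where "bc (x, y, w, a, b, l, i) = b"
fun lc :: "row \<Rightarrow> int" where "lc (x, y, w, a, b, l, i) = l"
fun ic :: "row \<Rightarrow> int" where "ic (x, y, w, a, b, l, i) = i"

definition base_points :: "row list" where
  "base_points =
  [(-2732, -4036, 37, 12, 19, 376, 146822674), (-2440, -3574, 16, 9, 13, 389, 118239160), (-2373, -3466, 16, 21, 29, 389, 102962744),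
   (-2358, -3442, 11, 23, 37, 393, 91268914), (-2256, -3304, 13, 11, 15, 393, 81437642), (-2214, -3248, 9, 19, 26, 395, 73300986),
   (-2200, -3228, 6, 16, 23, 398, 68125416), (-1785, -2523, 9, 53, 85, 393, 63106154), (-1715, -2404, 8, 19, 32, 394, 57899608),
   (-1647, -2290, 11, 3, 5, 394, 52567858), (-1626, -2254, 7, 16, 27, 395, 47981978), (-1304, 2732, 37, 7, -12, 376, 146822674),
   (-1212, -1850, 16, 6, 7, 390, 41549672), (-1134, 2440, 16, 4, -9, 389, 118239160), (-1126, -1761, 17, 326, 405, 389, 34618450),
   (-1093, 2373, 16, 8, -21, 389, 102962744), (-1084, 2358, 11, 14, -23, 393, 91268914), (-1048, 2256, 13, 4, -11, 393, 81437642),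
   (-1034, 2214, 9, 7, -19, 395, 73300986), (-1029, -1675, 17, 17, 15, 392, 29046802), (-1028, 2200, 6, 7, -16, 398, 68125416),
   (-890, -1044, 20, 17, 28, 392, 22674472), (-880, -995, 12, 77, 130, 390, 19399880), (-868, -964, 16, 57, 97, 391, 17434840),
   (-738, 1785, 9, 32, -53, 393, 63106154), (-689, 1715, 8, 13, -19, 394, 57899608), (-646, 1029, 17, 2, 17, 389, 29046802),
   (-643, 1647, 11, 2, -3, 394, 52567858), (-638, 1212, 16, 1, -8, 390, 41549672), (-635, 1126, 17, 79, -326, 389, 34618450),
   (-628, 1626, 7, 11, -16, 395, 47981978), (-414, 214, 13, 10, -41, 394, 13515546), (-413, 210, 12, 35, 92, 393, 13019352),
   (-214, -628, 13, 41, 51, 394, 13515546), (-210, -623, 12, 92, 57, 393, 13019352), (-154, 890, 20, 11, -17, 392, 22674472),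
   (-115, 880, 12, 53, -77, 390, 19399880), (-96, 868, 16, 40, -57, 391, 17434840), (623, 413, 12, 57, -35, 393, 13019352),
   (628, 414, 13, 51, 10, 391, 13515546), (964, 96, 16, 97, 40, 391, 17434840), (995, 115, 12, 130, 53, 396, 19399880),
   (1044, 154, 20, 28, 11, 386, 22674472), (1675, 646, 17, 15, -2, 389, 29046802), (1761, 635, 17, 405, 79, 392, 34618450),
   (1850, 638, 16, 7, 1, 392, 41549672), (2254, 628, 7, 27, 11, 396, 47981978), (2290, 643, 11, 5, 2, 393, 52567858),
   (2404, 689, 8, 32, 13, 396, 57899608), (2523, 738, 9, 85, 32, 396, 63106154), (3228, 1028, 6, 23, 7, 394, 68125416),
   (3248, 1034, 9, 26, 7, 394, 73300986), (3304, 1048, 13, 15, 4, 392, 81437642), (3442, 1084, 11, 37, 14, 394, 91268914),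
   (3466, 1093, 16, 29, 8, 393, 102962744), (3574, 1134, 16, 13, 4, 393, 118239160), (4036, 1304, 37, 19, 7, 385, 146822674)]"

text \<open>The vector from \<open>p\<close> to \<open>q\<close>, reflected into the right half plane; the reflection is recorded in the
  sign of the weight.\<close>

definition ray :: "row \<Rightarrow> row \<Rightarrow> int \<times> int \<times> int" where
  "ray p q = (if xc p < xc q then (xc q - xc p, yc q - yc p, wc q) else (xc p - xc q, yc p - yc q, - wc q))"

text \<open>Fixed-point slope with 20 binary digits after the point
  (\<open>1048576 = 2 ^ 20\<close>), so that sorting compares only integers.\<close>

fun approx_slope :: "int \<times> int \<times> int \<Rightarrow> int" where
  "approx_slope (dx, dy, z) = (dy * 1048576) div dx"

fun less_slope :: "int \<times> int \<times> int \<Rightarrow> int \<times> int \<times> int \<Rightarrow> bool" where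
  "less_slope (dx, dy, z) (dx', dy', z') \<longleftrightarrow> dy * dx' < dy' * dx"

text \<open>The sorting key is a rounded slope, so nothing is proved about the order of \<open>radial p\<close>; that it is
  the order of the exact slopes is checked afterwards by \<open>radial_ok\<close>.\<close>

definition radial :: "row \<Rightarrow> (int \<times> int \<times> int) list" where
  "radial p = map snd (sort_key fst (map (\<lambda>u. (approx_slope u, u)) (map (ray p) (filter (\<lambda>q. q \<noteq> p) base_points))))"

fun total_scan :: "int list \<Rightarrow> int" where
  "total_scan zs = scan (sum_list zs) zs"

text \<open>The list is an argument, so both checks can share one evaluation of
  \<open>radial p\<close>.\<close>

fun radial_ok :: "int \<Rightarrow> (int \<times> int \<times> int) list \<Rightarrow> bool" where
  "radial_ok i us \<longleftrightarrow> successively less_slope us \<and> total_scan (map (snd \<circ> snd) us) = i"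

definition left_weight :: "row \<Rightarrow> int" where
  "left_weight p = sum_list (map (\<lambda>q. if q \<noteq> p \<and> bc p * (xc q - xc p) < ac p * (yc q - yc p) then wc q else 0) base_points)"

definition row_ok :: "row \<Rightarrow> bool" where
  "row_ok p \<longleftrightarrow> 0 < wc p \<and> 0 < ac p \<and>
     list_all (\<lambda>q. q = p \<or> ac p * (yc q - yc p) \<noteq> bc p * (xc q - xc p)) base_points \<and>
     left_weight p = lc p \<and> radial_ok (ic p) (radial p)"

text \<open>Three times the contribution of a row to the sum of \<open>crossing_sum\<close> and \<open>degenerate_sum\<close>; 798, 13650
  and 293712 are the sums of the first, second and third powers of the weights.\<close>

fun row_value :: "row \<Rightarrow> int" where
  "row_value (x, y, w, a, b, l, i) =
     3 * w * (i - (798 - w) * (13650 - w ^ 2) + (293712 - w ^ 3)) + 6 * w ^ 2 * (l ^ 2 + (798 - w - l) ^ 2 - (13650 - w ^ 2))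
     + 3 * w ^ 2 * (13650 - w ^ 2) + 2 * w ^ 3 * (798 - w)"

lemma weight_sums:
  "sum_list (map wc base_points) = 798" "sum_list (map (\<lambda>p. wc p ^ 2) base_points) = 13650"
  "sum_list (map (\<lambda>p. wc p ^ 3) base_points) = 293712" "sum_list (map (\<lambda>p. wc p ^ 4) base_points) = 7836414"
  by code_simp+

lemma base_points_sorted: "successively (\<lambda>p q. xc p < xc q) base_points"
  by code_simp

text \<open>The 57 rows are evaluated in four separate blocks, which \<open>row_okD\<close>
  reassembles.\<close>

lemma row_ok_chunk1: "list_all row_ok (take 15 base_points)"
  by code_simp

lemma row_ok_chunk2: "list_all row_ok (take 14 (drop 15 base_points))"
  by code_simp

lemma row_ok_chunk3: "list_all row_ok (take 14 (drop 14 (drop 15 base_points)))"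
  by code_simp

lemma row_ok_chunk4: "list_all row_ok (drop 14 (drop 14 (drop 15 base_points)))"
  by code_simp

text \<open>The decisive numerical comparison. The row values add up to three times the factor
  \<open>G\<close> of the recursion, and the right-hand bracket is \<open>W ^ 4\<close> minus the
  sum of the fourth powers of the weights.\<close>

lemma row_value_sum: "24609375 * sum_list (map row_value base_points) \<le> 9363184 * (798 ^ 4 - 7836414)"
  by code_simp

section \<open>From integer certificates to real sums\<close>

abbreviation row_pt :: "row \<Rightarrow> point" where
  "row_pt p \<equiv> (real_of_int (xc p), real_of_int (yc p))"

abbreviation row_dir :: "row \<Rightarrow> point" where
  "row_dir p \<equiv> (real_of_int (ac p), real_of_int (bc p))"

abbreviation row_wt :: "row \<Rightarrow> real" where
  "row_wt p \<equiv> real_of_int (wc p)"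

definition ray_slope :: "int \<times> int \<times> int \<Rightarrow> real" where
  "ray_slope u = real_of_int (fst (snd u)) / real_of_int (fst u)"

lemma base_points_sorted_wrt: "sorted_wrt (\<lambda>p q. xc p < xc q) base_points"
  using base_points_sorted by (subst (asm) successively_conv_sorted_wrt) (auto simp: transp_on_def)

lemma distinct_xc: "distinct (map xc base_points)"
proof -
  have "sorted_wrt (<) (map xc base_points)" using base_points_sorted_wrt by (simp add: sorted_wrt_map)
  then show ?thesis by (simp add: strict_sorted_iff)
qed

lemma distinct_rows: "distinct base_points"
  using distinct_xc by (simp add: distinct_map)

lemma xc_neq: "p \<in> set base_points \<Longrightarrow> q \<in> set base_points \<Longrightarrow> p \<noteq> q \<Longrightarrow> xc p \<noteq> xc q"
  using distinct_xc by (auto simp: distinct_map dest: inj_onD)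

lemma sum_rows: "(\<Sum>p\<in>set base_points. f p) = sum_list (map f base_points)"
  using distinct_rows by (simp add: sum.distinct_set_conv_list)

lemma of_int_sum_list: "real_of_int (sum_list xs) = sum_list (map real_of_int xs)"
  by (induction xs) simp_all

text \<open>Sorting only permutes, whatever the key; hence sums over \<open>radial p\<close> are
  sums over the other points.\<close>

lemma mset_radial: "mset (radial p) = image_mset (ray p) (mset (filter (\<lambda>q. q \<noteq> p) base_points))"
  by (simp add: radial_def image_mset.compositionality o_def)

lemma sum_list_radial:
  fixes g :: "int \<times> int \<times> int \<Rightarrow> real"
  shows "(\<Sum>u\<leftarrow>radial p. g u) = (\<Sum>q\<in>set base_points - {p}. g (ray p q))"
proof -
  have "(\<Sum>u\<leftarrow>radial p. g u) = sum_mset (image_mset g (mset (radial p)))"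
    by (metis mset_map sum_mset_sum_list)
  also have "\<dots> = sum_list (map (\<lambda>q. g (ray p q)) (filter (\<lambda>q. q \<noteq> p) base_points))"
    unfolding mset_radial by (simp add: image_mset.compositionality o_def flip: sum_mset_sum_list)
  also have "\<dots> = (\<Sum>q\<in>set (filter (\<lambda>q. q \<noteq> p) base_points). g (ray p q))"
    using distinct_rows by (subst sum.distinct_set_conv_list) auto
  also have "set (filter (\<lambda>q. q \<noteq> p) base_points) = set base_points - {p}" by auto
  finally show ?thesis .
qed

lemma ray_fst_pos:
  assumes "p \<in> set base_points" "u \<in> set (radial p)" shows "fst u > 0"
proof -
  have "set (radial p) = ray p ` (set base_points - {p})"
    using arg_cong[OF mset_radial[of p], of set_mset] by auto
  then obtain q where "q \<in> set base_points" "q \<noteq> p" "u = ray p q" using assms(2) by blast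
  with assms(1) xc_neq[of p q] show ?thesis by (auto simp: ray_def)
qed

lemma row_okD: "p \<in> set base_points \<Longrightarrow> row_ok p"
proof -
  have "list_all row_ok base_points"
    using row_ok_chunk1 row_ok_chunk2 row_ok_chunk3 row_ok_chunk4
    by (metis append_take_drop_id list_all_append)
  then show "p \<in> set base_points \<Longrightarrow> row_ok p" by (simp add: list_all_iff)
qed

lemma radial_sorted:
  assumes "p \<in> set base_points"
  shows "sorted_wrt (\<lambda>u u'. ray_slope u < ray_slope u') (radial p)"
proof -
  have "less_slope u u' \<longleftrightarrow> ray_slope u < ray_slope u'" if "u \<in> set (radial p)" "u' \<in> set (radial p)" for u u'
  proof -
    obtain dx dy z dx' dy' z' where u: "u = (dx, dy, z)" "u' = (dx', dy', z')"
      by (metis prod_cases3)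
    have "dx > 0" "dx' > 0" using that ray_fst_pos[OF assms] u by force+
    then have "ray_slope u < ray_slope u' \<longleftrightarrow> real_of_int (dy * dx') < real_of_int (dy' * dx)"
      by (simp add: u ray_slope_def field_simps)
    then show ?thesis by (simp only: u less_slope.simps of_int_less_iff)
  qed
  moreover have "successively less_slope (radial p)"
    using row_okD[OF assms] by (simp add: row_ok_def)
  ultimately have "successively (\<lambda>u u'. ray_slope u < ray_slope u') (radial p)"
    by (blast intro: successively_mono)
  then show ?thesis
    by (subst (asm) successively_conv_sorted_wrt) (auto simp: transp_on_def)
qed

text \<open>The strict order verified for the sweep also certifies general position: points
  collinear with \<open>p\<close> would have equal slopes, even on opposite sides of
  \<open>p\<close>.\<close>

lemma ray_slope_inj:
  assumes "p \<in> set base_points" "q \<in> set base_points" "r \<in> set base_points" "q \<noteq> p" "r \<noteq> p" "q \<noteq> r"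
  shows "ray_slope (ray p q) \<noteq> ray_slope (ray p r)"
proof -
  have "sorted_wrt (<) (map ray_slope (radial p))"
    using radial_sorted[OF assms(1)] by (simp add: sorted_wrt_map)
  then have "distinct (map ray_slope (radial p))" by (simp add: strict_sorted_iff)
  moreover have "mset (map ray_slope (radial p)) = mset (map (\<lambda>q. ray_slope (ray p q)) (filter (\<lambda>q. q \<noteq> p) base_points))"
    using mset_radial[of p] by (simp add: image_mset.compositionality o_def)
  ultimately have "distinct (map (\<lambda>q. ray_slope (ray p q)) (filter (\<lambda>q. q \<noteq> p) base_points))"
    using mset_eq_imp_distinct_iff by blast
  then show ?thesis using assms by (auto simp: distinct_map dest: inj_onD)
qed

definition dir_sign :: "row \<Rightarrow> row \<Rightarrow> real" where
  "dir_sign p q = (if xc p < xc q then 1 else - 1)"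

text \<open>Reflecting \<open>q\<close> or \<open>r\<close> through \<open>p\<close> negates the
  orientation. After both are moved into the right half plane, the orientation compares
  slopes.\<close>

lemma orient_rows:
  assumes "p \<in> set base_points" "q \<in> set base_points" "r \<in> set base_points" "q \<noteq> p" "r \<noteq> p"
  shows "sgn (orient (row_pt p) (row_pt q) (row_pt r))
    = dir_sign p q * dir_sign p r * sgn (ray_slope (ray p r) - ray_slope (ray p q))"
proof -
  have x: "xc p \<noteq> xc q" "xc p \<noteq> xc r" using assms xc_neq[of p q] xc_neq[of p r] by auto
  have pos: "real_of_int (fst (ray p q)) > 0" "real_of_int (fst (ray p r)) > 0" using x by (auto simp: ray_def)
  have "orient (row_pt p) (row_pt q) (row_pt r) = dir_sign p q * dir_sign p r *
      (real_of_int (fst (ray p q)) * real_of_int (fst (snd (ray p r)))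
        - real_of_int (fst (snd (ray p q))) * real_of_int (fst (ray p r)))"
    by (simp add: orient_def dir_sign_def ray_def algebra_simps)
  also have "\<dots> = dir_sign p q * dir_sign p r * (real_of_int (fst (ray p q)) * real_of_int (fst (ray p r)) *
      (ray_slope (ray p r) - ray_slope (ray p q)))"
    using pos by (simp add: ray_slope_def field_simps)
  finally show ?thesis using pos by (simp add: sgn_mult dir_sign_def)
qed

interpretation rows: configuration "set base_points" row_pt row_dir
proof
  fix p q r assume *: "p \<in> set base_points" "q \<in> set base_points" "r \<in> set base_points" "p \<noteq> q" "p \<noteq> r" "q \<noteq> r"
  then have "sgn (orient (row_pt p) (row_pt q) (row_pt r)) \<noteq> 0"
    using orient_rows[of p q r] ray_slope_inj[of p q r] by (simp add: dir_sign_def sgn_0_0)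
  then show "orient (row_pt p) (row_pt q) (row_pt r) \<noteq> 0" by (simp add: sgn_0_0)
next
  fix p q assume *: "p \<in> set base_points" "q \<in> set base_points" "p \<noteq> q"
  then show "fst (row_pt p) \<noteq> fst (row_pt q)" using xc_neq by auto
  have "ac p * (yc q - yc p) \<noteq> bc p * (xc q - xc p)"
    using row_okD[OF *(1)] * by (auto simp: row_ok_def list_all_iff)
  then have "real_of_int (ac p * (yc q - yc p)) \<noteq> real_of_int (bc p * (xc q - xc p))"
    by (simp only: of_int_eq_iff not_False_eq_True)
  then show "side (row_dir p) (row_pt p) (row_pt q) \<noteq> 0" by (simp add: side_def)
next
  fix p assume "p \<in> set base_points"
  then show "fst (row_dir p) \<noteq> 0" using row_okD[of p] by (simp add: row_ok_def)
qed simp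

lemma wc_pos: "p \<in> set base_points \<Longrightarrow> wc p > 0"
  using row_okD by (simp add: row_ok_def)

lemma weight_sums_real:
  "(\<Sum>p\<in>set base_points. row_wt p) = 798" "(\<Sum>p\<in>set base_points. row_wt p ^ 2) = 13650"
  "(\<Sum>p\<in>set base_points. row_wt p ^ 3) = 293712" "(\<Sum>p\<in>set base_points. row_wt p ^ 4) = 7836414"
  using weight_sums(1)[THEN arg_cong, of real_of_int] weight_sums(2)[THEN arg_cong, of real_of_int]
    weight_sums(3)[THEN arg_cong, of real_of_int] weight_sums(4)[THEN arg_cong, of real_of_int]
  by (simp_all add: sum_rows of_int_sum_list o_def)

lemma other_sum_rows: "p \<in> set base_points \<Longrightarrow> rows.other_sum f p = (\<Sum>q\<in>set base_points. f q) - f p"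
proof -
  assume "p \<in> set base_points"
  then have "(\<Sum>q\<in>set base_points. f q) = f p + (\<Sum>q\<in>set base_points - {p}. f q)"
    by (simp add: sum.remove)
  moreover have "rows.other_sum f p = (\<Sum>q\<in>set base_points - {p}. f q)"
    unfolding rows.other_sum_def by (intro sum.mono_neutral_cong_right) auto
  ultimately show ?thesis by simp
qed

lemma left_sum_rows: "p \<in> set base_points \<Longrightarrow> rows.left_sum row_wt p = real_of_int (lc p)"
proof -
  assume p: "p \<in> set base_points"
  then have "lc p = left_weight p" using row_okD by (simp add: row_ok_def)
  moreover
  have "side (row_dir p) (row_pt p) (row_pt q) > 0 \<longleftrightarrow> bc p * (xc q - xc p) < ac p * (yc q - yc p)" for q
  proof -
    have "side (row_dir p) (row_pt p) (row_pt q) > 0 \<longleftrightarrow>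
        real_of_int (bc p * (xc q - xc p)) < real_of_int (ac p * (yc q - yc p))"
      by (simp add: side_def)
    then show ?thesis by (simp only: of_int_less_iff)
  qed
  ultimately show ?thesis
    by (simp add: rows.left_sum_def left_weight_def sum_rows of_int_sum_list o_def if_distrib cong: if_cong)
qed

text \<open>The sign \<open>dir_sign p r\<close> is absorbed into the signed weight of the ray,
  while \<open>dir_sign p q\<close> is a common factor that disappears on squaring. What remains is
  the sum computed by the sweep.\<close>

lemma imbalance_rows:
  assumes p: "p \<in> set base_points"
  shows "(\<Sum>q\<in>set base_points. row_wt q * (\<Sum>r\<in>set base_points. row_wt r * sgn (orient (row_pt p) (row_pt q) (row_pt r)))\<^sup>2)
    = real_of_int (ic p)"
proof -
  let ?z = "\<lambda>u :: int \<times> int \<times> int. real_of_int (snd (snd u))"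
  let ?I = "set base_points - {p}"
  have z: "?z (ray p q) = dir_sign p q * row_wt q" for q by (simp add: dir_sign_def ray_def)
  have inner: "(\<Sum>r\<in>set base_points. row_wt r * sgn (orient (row_pt p) (row_pt q) (row_pt r)))
      = dir_sign p q * (\<Sum>u\<leftarrow>radial p. ?z u * sgn (ray_slope u - ray_slope (ray p q)))" if "q \<in> ?I" for q
  proof -
    have "(\<Sum>r\<in>set base_points. row_wt r * sgn (orient (row_pt p) (row_pt q) (row_pt r)))
        = (\<Sum>r\<in>?I. row_wt r * sgn (orient (row_pt p) (row_pt q) (row_pt r)))"
      by (rule sum.mono_neutral_right) auto
    also have "\<dots> = (\<Sum>r\<in>?I. dir_sign p q * (?z (ray p r) * sgn (ray_slope (ray p r) - ray_slope (ray p q))))"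
      using that p by (intro sum.cong refl) (simp add: orient_rows z)
    finally show ?thesis by (simp add: sum_list_radial sum_distrib_left)
  qed
  have "(\<Sum>q\<in>set base_points. row_wt q * (\<Sum>r\<in>set base_points. row_wt r * sgn (orient (row_pt p) (row_pt q) (row_pt r)))\<^sup>2)
      = (\<Sum>q\<in>?I. row_wt q * (\<Sum>r\<in>set base_points. row_wt r * sgn (orient (row_pt p) (row_pt q) (row_pt r)))\<^sup>2)"
    by (rule sum.mono_neutral_right) auto
  also have "\<dots> = (\<Sum>q\<in>?I. \<bar>?z (ray p q)\<bar> * (\<Sum>u\<leftarrow>radial p. ?z u * sgn (ray_slope u - ray_slope (ray p q)))\<^sup>2)"
  proof (intro sum.cong refl)
    fix q assume q: "q \<in> ?I"
    have "\<bar>?z (ray p q)\<bar> = row_wt q" "(dir_sign p q)\<^sup>2 = 1"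
      using wc_pos[of q] q by (auto simp: z dir_sign_def abs_mult)
    then show "row_wt q * (\<Sum>r\<in>set base_points. row_wt r * sgn (orient (row_pt p) (row_pt q) (row_pt r)))\<^sup>2
        = \<bar>?z (ray p q)\<bar> * (\<Sum>u\<leftarrow>radial p. ?z u * sgn (ray_slope u - ray_slope (ray p q)))\<^sup>2"
      unfolding inner[OF q] by (simp add: power_mult_distrib)
  qed
  also have "\<dots> = (\<Sum>u'\<leftarrow>radial p. \<bar>?z u'\<bar> * (\<Sum>u\<leftarrow>radial p. ?z u * sgn (ray_slope u - ray_slope u'))\<^sup>2)"
    by (rule sum_list_radial[symmetric])
  also have "\<dots> = scan (sum_list (map ?z (radial p))) (map ?z (radial p))"
    using scan_sorted_wrt[of ray_slope "[]" "radial p" ?z] radial_sorted[OF p] by simp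
  also have "\<dots> = real_of_int (ic p)"
  proof -
    have "ic p = total_scan (map (snd \<circ> snd) (radial p))"
      using row_okD[OF p] by (simp add: row_ok_def)
    then show ?thesis by (simp add: of_int_scan of_int_sum_list o_def)
  qed
  finally show ?thesis .
qed

text \<open>In general position the squared sign is 1 for every \<open>r\<close> other than
  \<open>p\<close> and \<open>q\<close>, so only power sums of the weights remain.\<close>

lemma squares_rows:
  assumes p: "p \<in> set base_points"
  shows "(\<Sum>q\<in>set base_points. row_wt q * (\<Sum>r\<in>set base_points. (row_wt r)\<^sup>2 * (sgn (orient (row_pt p) (row_pt q) (row_pt r)))\<^sup>2))
    = (798 - row_wt p) * (13650 - (row_wt p)\<^sup>2) - (293712 - row_wt p ^ 3)"
proof -
  let ?g = "\<lambda>q. \<Sum>r\<in>set base_points. (row_wt r)\<^sup>2 * (sgn (orient (row_pt p) (row_pt q) (row_pt r)))\<^sup>2"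
  have g: "?g q = 13650 - (row_wt p)\<^sup>2 - (row_wt q)\<^sup>2" if q: "q \<in> set base_points" "q \<noteq> p" for q
  proof -
    have "?g q = (\<Sum>r\<in>set base_points - {p} - {q}. (row_wt r)\<^sup>2)"
    proof (intro sum.mono_neutral_cong_right ballI)
      fix r assume "r \<in> set base_points - {p} - {q}"
      then show "(row_wt r)\<^sup>2 * (sgn (orient (row_pt p) (row_pt q) (row_pt r)))\<^sup>2 = (row_wt r)\<^sup>2"
        using rows.orient_pt[of p q r] p q by (auto simp: sgn_if)
    qed auto
    also have "\<dots> = (\<Sum>r\<in>set base_points. (row_wt r)\<^sup>2) - (row_wt p)\<^sup>2 - (row_wt q)\<^sup>2"
      using p q by (simp add: sum_diff1)
    finally show ?thesis by (simp add: weight_sums_real)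
  qed
  have "(\<Sum>q\<in>set base_points. row_wt q * ?g q) = (\<Sum>q\<in>set base_points - {p}. row_wt q * ?g q)"
    by (rule sum.mono_neutral_right) auto
  also have "\<dots> = (\<Sum>q\<in>set base_points - {p}. row_wt q * (13650 - (row_wt p)\<^sup>2) - row_wt q ^ 3)"
  proof (intro sum.cong refl)
    fix q assume "q \<in> set base_points - {p}"
    then have "?g q = 13650 - (row_wt p)\<^sup>2 - (row_wt q)\<^sup>2" using g by blast
    then show "row_wt q * ?g q = row_wt q * (13650 - (row_wt p)\<^sup>2) - row_wt q ^ 3"
      by (simp only:) (simp add: algebra_simps power3_eq_cube power2_eq_square)
  qed
  also have "\<dots> = (\<Sum>q\<in>set base_points - {p}. row_wt q) * (13650 - (row_wt p)\<^sup>2) - (\<Sum>q\<in>set base_points - {p}. row_wt q ^ 3)"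
    by (simp add: sum_subtractf sum_distrib_right)
  finally show ?thesis using p by (simp add: sum_diff1 weight_sums_real)
qed

lemma row_value_eq: "row_value p =
     3 * wc p * (ic p - (798 - wc p) * (13650 - wc p ^ 2) + (293712 - wc p ^ 3))
     + 6 * wc p ^ 2 * (lc p ^ 2 + (798 - wc p - lc p) ^ 2 - (13650 - wc p ^ 2))
     + 3 * wc p ^ 2 * (13650 - wc p ^ 2) + 2 * wc p ^ 3 * (798 - wc p)"
  by (cases p) simp

text \<open>The factor 3 clears the denominator of \<open>2 / 3\<close> in
  \<open>degenerate_sum\<close>, so that the certificate stays integral.\<close>

lemma total_rows:
  "3 * (rows.crossing_sum row_wt + rows.degenerate_sum row_wt) = real_of_int (sum_list (map row_value base_points))"
proof -
  have lin: "(\<Sum>q\<in>J. c * f q * (A q - B q)) = c * ((\<Sum>q\<in>J. f q * A q) - (\<Sum>q\<in>J. f q * B q))"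
    for J and c :: real and f A B :: "row \<Rightarrow> real"
    by (simp add: sum_subtractf sum_distrib_left algebra_simps)
  have "rows.crossing_sum row_wt = (\<Sum>p\<in>set base_points. row_wt p * (real_of_int (ic p)
      - ((798 - row_wt p) * (13650 - (row_wt p)\<^sup>2) - (293712 - row_wt p ^ 3))))"
    unfolding rows.crossing_sum_eq
  proof (intro sum.cong refl)
    fix p assume p: "p \<in> set base_points"
    show "(\<Sum>q\<in>set base_points. row_wt p * row_wt q * ((\<Sum>r\<in>set base_points. row_wt r * sgn (orient (row_pt p) (row_pt q) (row_pt r)))\<^sup>2
        - (\<Sum>r\<in>set base_points. (row_wt r)\<^sup>2 * (sgn (orient (row_pt p) (row_pt q) (row_pt r)))\<^sup>2)))
      = row_wt p * (real_of_int (ic p) - ((798 - row_wt p) * (13650 - (row_wt p)\<^sup>2) - (293712 - row_wt p ^ 3)))"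
      unfolding lin imbalance_rows[OF p] squares_rows[OF p] ..
  qed
  moreover have "rows.degenerate_sum row_wt = (\<Sum>p\<in>set base_points. 2 * row_wt p ^ 2 *
        (real_of_int (lc p) ^ 2 + (798 - row_wt p - real_of_int (lc p)) ^ 2 - (13650 - row_wt p ^ 2))
      + row_wt p ^ 2 * (13650 - row_wt p ^ 2) + 2 / 3 * row_wt p ^ 3 * (798 - row_wt p))"
    unfolding rows.degenerate_sum_def
  proof (intro sum.cong refl)
    fix p assume p: "p \<in> set base_points"
    have "rows.right_sum row_wt p = 798 - row_wt p - real_of_int (lc p)"
      using rows.left_sum_plus_right_sum[OF p, of row_wt] other_sum_rows[OF p, of row_wt]
      by (simp add: left_sum_rows[OF p] weight_sums_real)
    then show "2 * row_wt p ^ 2 * (rows.left_sum row_wt p ^ 2 + rows.right_sum row_wt p ^ 2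
          - rows.other_sum (\<lambda>q. row_wt q ^ 2) p)
        + row_wt p ^ 2 * rows.other_sum (\<lambda>q. row_wt q ^ 2) p + 2 / 3 * row_wt p ^ 3 * rows.other_sum row_wt p
      = 2 * row_wt p ^ 2 *
        (real_of_int (lc p) ^ 2 + (798 - row_wt p - real_of_int (lc p)) ^ 2 - (13650 - row_wt p ^ 2))
      + row_wt p ^ 2 * (13650 - row_wt p ^ 2) + 2 / 3 * row_wt p ^ 3 * (798 - row_wt p)"
      by (simp add: left_sum_rows[OF p] other_sum_rows[OF p] weight_sums_real)
  qed
  ultimately have "3 * (rows.crossing_sum row_wt + rows.degenerate_sum row_wt)
      = (\<Sum>p\<in>set base_points. real_of_int (row_value p))"
    by (simp add: sum_distrib_left sum.distrib[symmetric]) (intro sum.cong refl, simp add: row_value_eq algebra_simps)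
  then show ?thesis by (simp add: sum_rows of_int_sum_list o_def)
qed

section \<open>The final estimate\<close>

lemma min_crossings_bound:
  assumes "4 \<le> n"
  shows "real (min_crossings n) \<le> 9363184 / 24609375 * real n ^ 4 / 3"
proof -
  let ?D = "798 ^ 4 - 7836414 :: real"
  have wt: "real (nat (wc p)) = row_wt p" if "p \<in> set base_points" for p
    using wc_pos[OF that] by simp
  have "((\<Sum>p\<in>set base_points. real (nat (wc p))) ^ 4 - (\<Sum>p\<in>set base_points. real (nat (wc p)) ^ 4)) * real (min_crossings n)
      \<le> (rows.crossing_sum (\<lambda>p. real (nat (wc p))) + rows.degenerate_sum (\<lambda>p. real (nat (wc p)))) * real n ^ 4"
    using assms wc_pos by (intro rows.min_crossings_weighted) (auto simp: wt weight_sums_real base_points_def)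
  moreover have "rows.crossing_sum (\<lambda>p. real (nat (wc p))) = rows.crossing_sum row_wt"
    by (simp add: rows.crossing_sum_def wt cong: sum.cong)
  moreover have "rows.degenerate_sum (\<lambda>p. real (nat (wc p))) = rows.degenerate_sum row_wt"
    by (simp add: rows.degenerate_sum_def rows.left_sum_def rows.right_sum_def rows.other_sum_def wt cong: sum.cong if_cong)
  ultimately have le1: "?D * real (min_crossings n) \<le> (rows.crossing_sum row_wt + rows.degenerate_sum row_wt) * real n ^ 4"
    by (simp add: wt weight_sums_real cong: sum.cong)
  have le2: "rows.crossing_sum row_wt + rows.degenerate_sum row_wt \<le> 9363184 / 24609375 * ?D / 3"
  proof -
    have "real_of_int (24609375 * sum_list (map row_value base_points)) \<le> real_of_int (9363184 * (798 ^ 4 - 7836414))"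
      using row_value_sum by (simp only: of_int_le_iff)
    then have "24609375 * (3 * (rows.crossing_sum row_wt + rows.degenerate_sum row_wt)) \<le> 9363184 * ?D"
      by (simp only: total_rows of_int_mult of_int_diff of_int_power of_int_numeral)
    then show ?thesis by simp
  qed
  have "?D * real (min_crossings n) \<le> (9363184 / 24609375 * ?D / 3) * real n ^ 4"
    by (rule order_trans[OF le1 mult_right_mono[OF le2]]) simp
  then have "?D * real (min_crossings n) \<le> ?D * (9363184 / 24609375 * real n ^ 4 / 3)"
    by (simp add: ac_simps)
  then show ?thesis by (subst (asm) mult_le_cancel_left_pos) simp_all
qed

theorem theorem1:
  shows "\<exists>C::real. C > 0 \<and> (\<forall>n::nat. n \<ge> 4 \<longrightarrow>
           real (rect_cr n) \<le> 9363184 / 24609375 * real (n choose 4) + C * real n ^ 3)"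
proof (intro exI[of _ 1] conjI allI impI)
  fix n :: nat assume n: "4 \<le> n"
  have "8 * real (rect_cr n) \<le> real (min_crossings n)"
    using of_nat_mono[OF rect_cr_le_min_crossings[of n], where 'a = real] by simp
  also note min_crossings_bound[OF n]
  \<comment> \<open>The 24 combines the eight ordered versions of a crossing with the factor 3 of
    the certificate.\<close>
  finally have le: "real (rect_cr n) \<le> 9363184 / 24609375 * (real n ^ 4 / 24)" by simp
  \<comment> \<open>The difference is at most \<open>n ^ 3\<close> and the leading coefficient is
    below 1, so the witness 1 for \<open>C\<close> suffices.\<close>
  have "real n ^ 4 / 24 - real (n choose 4) = (6 * real n ^ 3 - 11 * real n ^ 2 + 6 * real n) / 24"
    by (simp add: choose_4_real field_simps power4_eq_xxxx power3_eq_cube power2_eq_square)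
  also have "\<dots> \<le> real n ^ 3"
  proof -
    have "(6 * x ^ 3 - 11 * x ^ 2 + 6 * x) / 24 \<le> x ^ 3" if "x \<ge> 1" for x :: real
    proof -
      have "x \<le> x ^ 2" "0 \<le> x ^ 3" using that by (simp_all add: power2_eq_square)
      with that have "6 * x ^ 3 - 11 * x ^ 2 + 6 * x \<le> x ^ 3 * 24" by linarith
      then show ?thesis by simp
    qed
    then show ?thesis using n by simp
  qed
  finally have "9363184 / 24609375 * (real n ^ 4 / 24) \<le> 9363184 / 24609375 * (real (n choose 4) + real n ^ 3)"
    by (intro mult_left_mono) auto
  also have "\<dots> \<le> 9363184 / 24609375 * real (n choose 4) + 1 * real n ^ 3" by simp
  finally show "real (rect_cr n) \<le> 9363184 / 24609375 * real (n choose 4) + 1 * real n ^ 3"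
    using le by linarith
qed simp

end
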